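(* Consider binary-input CDMA with spreading coefficients satisfying Assumption A (with unit variance), and let $C_K$ be its capacity per user. Let $C_{g,K}$ be the capacity per user of the same system (same $K$, $N=K/\beta$, $\sigma$) with i.i.d. standard Gaussian spreading coefficients. Then $\lim_{K\to\infty}(C_K-C_{g,K})=0$.
   Context: CDMA model: $K$ users, $N$ chips, $K/N=\beta$ fixed. Spreading matrix $N\times K$ with i.i.d. entries $s_{ik}$. Inputs $x\in\{\pm1\}^K$ with distribution $p_X$. Output $y_i=N^{-1/2}\sum_k s_{ik}x_k+\sigma n_i$, $n_i$ i.i.d. $\mathcal N(0,1)$. Capacity per user: $C_K=\frac1K\max_{p_X}\mathbb E_S[I(X;Y)]$, where $I(X;Y)$ is the mutual information for a given spreading realization. Assumption A: symmetric distribution with $\mathbb P(s_{ik}\ge s)\le e^{-As^2}$ for all $s\ge s_0$, for some positive constants $s_0,A$. *)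

theory Defs
  imports "HOL-Probability.Probability"
begin

definition bin_inputs :: "nat \<Rightarrow> (nat \<Rightarrow> real) set" where
  "bin_inputs K = {x. (\<forall>i<K. x i \<in> {-1, 1}) \<and> (\<forall>i. K \<le> i \<longrightarrow> x i = 0)}"

definition cdma_space :: "nat \<Rightarrow> (nat \<Rightarrow> real) pmf \<Rightarrow> ((nat \<Rightarrow> real) \<times> (nat \<Rightarrow> real)) measure" where
  "cdma_space N p = measure_pmf p \<Otimes>\<^sub>M PiM {..<N} (\<lambda>_. std_normal_distribution)"

definition cdma_output :: "nat \<Rightarrow> nat \<Rightarrow> real \<Rightarrow> (nat \<Rightarrow> nat \<Rightarrow> real)
    \<Rightarrow> (nat \<Rightarrow> real) \<times> (nat \<Rightarrow> real) \<Rightarrow> (nat \<Rightarrow> real)" where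
  "cdma_output K N \<sigma> s = (\<lambda>(x, n). restrict (\<lambda>i. (\<Sum>k<K. s i k * x k) / sqrt (real N) + \<sigma> * n i) {..<N})"

definition cdma_MI :: "nat \<Rightarrow> nat \<Rightarrow> real \<Rightarrow> (nat \<Rightarrow> nat \<Rightarrow> real) \<Rightarrow> (nat \<Rightarrow> real) pmf \<Rightarrow> real" where
  "cdma_MI K N \<sigma> s p =
     prob_space.mutual_information (cdma_space N p) (exp 1)
       (count_space UNIV) (PiM {..<N} (\<lambda>_. borel)) fst (cdma_output K N \<sigma> s)"

definition spreading_law :: "nat \<Rightarrow> nat \<Rightarrow> real measure \<Rightarrow> (nat \<times> nat \<Rightarrow> real) measure" where
  "spreading_law K N \<mu> = PiM ({..<N} \<times> {..<K}) (\<lambda>_. \<mu>)"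

definition cdma_capacity :: "real measure \<Rightarrow> nat \<Rightarrow> nat \<Rightarrow> real \<Rightarrow> real" where
  "cdma_capacity \<mu> K N \<sigma> =
     (1 / real K) * (SUP p \<in> {p. set_pmf p \<subseteq> bin_inputs K}.
        integral\<^sup>L (spreading_law K N \<mu>) (\<lambda>S. cdma_MI K N \<sigma> (\<lambda>i k. S (i, k)) p))"

definition assumption_A :: "real measure \<Rightarrow> bool" where
  "assumption_A \<mu> \<longleftrightarrow> prob_space \<mu> \<and> sets \<mu> = sets borel \<and>
     distr \<mu> borel uminus = \<mu> \<and>
     (\<exists>s0 A. 0 < s0 \<and> 0 < A \<and> (\<forall>s\<ge>s0. measure \<mu> {s..} \<le> exp (- A * s\<^sup>2)))"

end

(*
  Up to a constant, the mutual information for a fixed spreading matrix is the free entropy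
  E[-ln Z], where Z is the posterior normalisation of a Gaussian channel. The Gaussian law is
  exchanged for the given one entry by entry. In one entry, normalised by 1/sqrt N, the third
  derivative of ln Z is bounded by posterior third moments of the residual of that chip; averaged
  over input and noise these are Gaussian third moments, by the Nishimori identity, whatever the
  input law and the remaining entries are. Since the first two moments of the entry laws agree, each
  exchange costs O(N^(-3/2)). The N K exchanges, divided by K, cost O(N^(-1/2)), uniformly in the
  input law, so the estimate passes to the suprema.
*)
theory Submission
  imports Defs "HOL-Real_Asymp.Real_Asymp"
begin

section \<open>Third-order expansion of a log-partition function\<close>

text \<open>The Nishimori identity is linear in the posterior: it evaluates the average of one
  posterior mean, not of a product of posterior means. The third derivative of \<open>ln Z\<close>
  does contain such products, so they are first bounded by a single posterior mean of a third
  moment; the weighted moment inequalities serve that purpose. The identity also requires that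
  posterior and channel match. Changing one spreading coefficient moves the true input and its
  replicas together and so gives another matched channel. Hence the identity applies at every
  intermediate point of the Taylor segment, with a value that does not depend on the point. The
  remainder is therefore at most a constant times |t|^3 for all real t, and unbounded entries call
  for no truncation. The linear and quadratic coefficients depend on the input law and on the other
  entries, but never have to be computed: they cancel between two laws with equal first and second
  moments.\<close>

text \<open>Symmetrisation: (V x - V y)^2 (V x + V y) equals V x^3 + V y^3 - V x^2 V y - V x V y^2,
  and its double sum with weights \<open>a x * a y\<close> is nonnegative. The weights are not
  normalised, so the total mass appears as a factor.\<close>

lemma weighted_moment_chebyshev:
  fixes a V :: "'a \<Rightarrow> real"
  assumes "\<And>x. x \<in> B \<Longrightarrow> 0 \<le> a x" "\<And>x. x \<in> B \<Longrightarrow> 0 \<le> V x"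
  shows "(\<Sum>x\<in>B. a x * V x) * (\<Sum>x\<in>B. a x * (V x)\<^sup>2) \<le> (\<Sum>x\<in>B. a x) * (\<Sum>x\<in>B. a x * V x ^ 3)"
proof -
  have "0 \<le> (\<Sum>x\<in>B. \<Sum>y\<in>B. a x * a y * ((V x - V y)\<^sup>2 * (V x + V y)))"
    using assms by (intro sum_nonneg mult_nonneg_nonneg) auto
  also have "\<dots> = (\<Sum>x\<in>B. \<Sum>y\<in>B. a x * (a y * V y ^ 3) + (a x * V x ^ 3) * a y
        - (a x * V x) * (a y * (V y)\<^sup>2) - (a x * (V x)\<^sup>2) * (a y * V y))"
    by (intro sum.cong refl) (simp add: power2_eq_square power3_eq_cube algebra_simps)
  also have "\<dots> = 2 * ((\<Sum>x\<in>B. a x) * (\<Sum>x\<in>B. a x * V x ^ 3)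
        - (\<Sum>x\<in>B. a x * V x) * (\<Sum>x\<in>B. a x * (V x)\<^sup>2))"
    by (simp add: sum.distrib sum_subtractf flip: sum_product)
  finally show ?thesis by simp
qed

lemma weighted_moment_cauchy:
  fixes a V :: "'a \<Rightarrow> real"
  assumes "\<And>x. x \<in> B \<Longrightarrow> 0 \<le> a x"
  shows "(\<Sum>x\<in>B. a x * V x)\<^sup>2 \<le> (\<Sum>x\<in>B. a x) * (\<Sum>x\<in>B. a x * (V x)\<^sup>2)"
proof -
  have "0 \<le> (\<Sum>x\<in>B. \<Sum>y\<in>B. a x * a y * (V x - V y)\<^sup>2)"
    using assms by (intro sum_nonneg mult_nonneg_nonneg) auto
  also have "\<dots> = (\<Sum>x\<in>B. \<Sum>y\<in>B. a x * (a y * (V y)\<^sup>2) + (a x * (V x)\<^sup>2) * a y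
        - 2 * ((a x * V x) * (a y * V y)))"
    by (intro sum.cong refl) (simp add: power2_eq_square algebra_simps)
  also have "\<dots> = 2 * ((\<Sum>x\<in>B. a x) * (\<Sum>x\<in>B. a x * (V x)\<^sup>2) - (\<Sum>x\<in>B. a x * V x)\<^sup>2)"
    by (simp add: sum.distrib sum_subtractf power2_eq_square flip: sum_distrib_left sum_distrib_right)
  finally show ?thesis by simp
qed

text \<open>Jensen for the cube: Cauchy-Schwarz merges two of the three factors into a second
  moment, and the preceding product inequality merges this with the remaining first moment.\<close>

lemma weighted_moment_cube:
  fixes a V :: "'a \<Rightarrow> real"
  assumes "\<And>x. x \<in> B \<Longrightarrow> 0 \<le> a x" "\<And>x. x \<in> B \<Longrightarrow> 0 \<le> V x"
  shows "(\<Sum>x\<in>B. a x * V x) ^ 3 \<le> (\<Sum>x\<in>B. a x)\<^sup>2 * (\<Sum>x\<in>B. a x * V x ^ 3)"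
proof -
  have V: "0 \<le> (\<Sum>x\<in>B. a x * V x)" and a: "0 \<le> (\<Sum>x\<in>B. a x)"
    using assms by (auto intro!: sum_nonneg)
  have "(\<Sum>x\<in>B. a x * V x) ^ 3 = (\<Sum>x\<in>B. a x * V x) * (\<Sum>x\<in>B. a x * V x)\<^sup>2"
    by (simp add: power2_eq_square power3_eq_cube)
  also have "\<dots> \<le> (\<Sum>x\<in>B. a x * V x) * ((\<Sum>x\<in>B. a x) * (\<Sum>x\<in>B. a x * (V x)\<^sup>2))"
    using weighted_moment_cauchy[of B a V] assms V by (intro mult_left_mono) auto
  also have "\<dots> = (\<Sum>x\<in>B. a x) * ((\<Sum>x\<in>B. a x * V x) * (\<Sum>x\<in>B. a x * (V x)\<^sup>2))"
    by (simp add: ac_simps)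
  also have "\<dots> \<le> (\<Sum>x\<in>B. a x) * ((\<Sum>x\<in>B. a x) * (\<Sum>x\<in>B. a x * V x ^ 3))"
    using weighted_moment_chebyshev[of B a V] assms a by (intro mult_left_mono) auto
  finally show ?thesis by (simp add: power2_eq_square ac_simps)
qed

text \<open>The likelihood factor of a single chip with residual \<open>u x\<close>;
  \<open>q\<close> will hold the prior and the factors of all other chips, which stay fixed while
  one coefficient varies.\<close>

definition gibbs_weight :: "('a \<Rightarrow> real) \<Rightarrow> ('a \<Rightarrow> real) \<Rightarrow> 'a \<Rightarrow> real" where
  "gibbs_weight q u x = q x * exp (- (u x)\<^sup>2 / 2)"

definition gibbs_mean :: "'a set \<Rightarrow> ('a \<Rightarrow> real) \<Rightarrow> ('a \<Rightarrow> real) \<Rightarrow> ('a \<Rightarrow> real) \<Rightarrow> real" where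
  "gibbs_mean B q u h = (\<Sum>x\<in>B. gibbs_weight q u x * h x) / (\<Sum>x\<in>B. gibbs_weight q u x)"

text \<open>The shift by 1 makes the cube dominate every polynomial that occurs: |u|, |u^2 - 1|, u^2
  and 3|u| + |u|^3.\<close>

definition cubic_moment :: "'a set \<Rightarrow> ('a \<Rightarrow> real) \<Rightarrow> ('a \<Rightarrow> real) \<Rightarrow> real" where
  "cubic_moment B q u = gibbs_mean B q u (\<lambda>x. (1 + \<bar>u x\<bar>) ^ 3)"

text \<open>The remainder stays an integral over \<open>\<theta>\<close>: the Nishimori identity controls the average of the
  cubic moment at each fixed \<open>\<theta>\<close>, but not of its supremum.\<close>

lemma log_partition_taylor:
  fixes q b w :: "'a \<Rightarrow> real"
  assumes B: "finite B" "B \<noteq> {}" and q: "\<And>x. x \<in> B \<Longrightarrow> 0 < q x"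
    and w: "\<And>x. x \<in> B \<Longrightarrow> \<bar>w x\<bar> \<le> \<rho>"
  defines "\<alpha> \<equiv> gibbs_mean B q b (\<lambda>x. w x * b x)"
    and "\<gamma> \<equiv> gibbs_mean B q b (\<lambda>x. (w x)\<^sup>2 * ((b x)\<^sup>2 - 1)) - (gibbs_mean B q b (\<lambda>x. w x * b x))\<^sup>2"
  shows "ennreal \<bar>ln (\<Sum>x\<in>B. gibbs_weight q (\<lambda>x. b x + w x) x) - ln (\<Sum>x\<in>B. gibbs_weight q b x)
           + \<alpha> - \<gamma> / 2\<bar>
       \<le> (\<integral>\<^sup>+\<theta>. ennreal (3 * \<rho> ^ 3 * cubic_moment B q (\<lambda>x. b x + \<theta> * w x)) * indicator {0..1} \<theta> \<partial>lborel)"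
proof -
  have \<rho>: "0 \<le> \<rho>" using B w by (meson abs_ge_zero ex_in_conv order_trans)
  define u where "u x \<theta> = b x + \<theta> * w x" for x \<theta>
  define E where "E x \<theta> = q x * exp (- (u x \<theta>)\<^sup>2 / 2)" for x \<theta>
  define Z where "Z \<theta> = (\<Sum>x\<in>B. E x \<theta>)" for \<theta>
  \<comment> \<open>The successive derivatives of \<open>Z\<close>: each differentiation multiplies
    the weight by \<open>- (w x * u x \<theta>)\<close> and also acts on the polynomial
    factor.\<close>
  define M1 where "M1 \<theta> = (\<Sum>x\<in>B. E x \<theta> * (- (w x * u x \<theta>)))" for \<theta>
  define M2 where "M2 \<theta> = (\<Sum>x\<in>B. E x \<theta> * ((w x * u x \<theta>)\<^sup>2 - (w x)\<^sup>2))" for \<theta>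
  define M3 where "M3 \<theta> = (\<Sum>x\<in>B. E x \<theta> * (3 * (w x) ^ 3 * u x \<theta> - (w x * u x \<theta>) ^ 3))" for \<theta>
  have Epos: "0 < E x \<theta>" if "x \<in> B" for x \<theta> using q[OF that] by (simp add: E_def)
  have Zpos: "0 < Z \<theta>" for \<theta> unfolding Z_def using B Epos by (intro sum_pos) auto
  have du: "(u x has_real_derivative w x) (at \<theta>)" for x \<theta>
    unfolding u_def by (auto intro!: derivative_eq_intros)
  have dE: "(E x has_real_derivative - (w x * u x \<theta>) * E x \<theta>) (at \<theta>)" for x \<theta>
    unfolding E_def by (auto intro!: derivative_eq_intros du)
  have dZ: "(Z has_real_derivative M1 \<theta>) (at \<theta>)" for \<theta>
    unfolding Z_def M1_def by (auto intro!: derivative_eq_intros dE sum.cong)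
  have dM1: "(M1 has_real_derivative M2 \<theta>) (at \<theta>)" for \<theta>
    unfolding M1_def M2_def
    by (auto intro!: derivative_eq_intros dE du sum.cong simp: algebra_simps power2_eq_square)
  have dM2: "(M2 has_real_derivative M3 \<theta>) (at \<theta>)" for \<theta>
    unfolding M2_def M3_def
    by (auto intro!: derivative_eq_intros dE du sum.cong simp: algebra_simps power2_eq_square power3_eq_cube)
  \<comment> \<open>Third derivative of \<open>ln Z\<close>, in the shape of a third
    cumulant.\<close>
  define D3 where "D3 \<theta> = M3 \<theta> / Z \<theta> - 3 * (M1 \<theta> * M2 \<theta>) / (Z \<theta>)\<^sup>2 + 2 * M1 \<theta> ^ 3 / Z \<theta> ^ 3" for \<theta>
  define D where "D i = (if i = 0 then (\<lambda>\<theta>. ln (Z \<theta>)) else if i = 1 then (\<lambda>\<theta>. M1 \<theta> / Z \<theta>)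
      else if i = 2 then (\<lambda>\<theta>. M2 \<theta> / Z \<theta> - (M1 \<theta> / Z \<theta>)\<^sup>2) else D3)" for i :: nat
  have d0: "((\<lambda>\<theta>. ln (Z \<theta>)) has_real_derivative M1 \<theta> / Z \<theta>) (at \<theta>)" for \<theta>
    using Zpos[of \<theta>] by (auto intro!: derivative_eq_intros dZ)
  have d1: "((\<lambda>\<theta>. M1 \<theta> / Z \<theta>) has_real_derivative M2 \<theta> / Z \<theta> - (M1 \<theta> / Z \<theta>)\<^sup>2) (at \<theta>)" for \<theta>
    using Zpos[of \<theta>] by (auto intro!: derivative_eq_intros dZ dM1 simp: field_simps power2_eq_square)
  have d2: "((\<lambda>\<theta>. M2 \<theta> / Z \<theta> - (M1 \<theta> / Z \<theta>)\<^sup>2) has_real_derivative D3 \<theta>) (at \<theta>)" for \<theta>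
    using Zpos[of \<theta>] unfolding D3_def
    by (auto intro!: derivative_eq_intros dZ dM1 dM2 simp: field_simps power2_eq_square power3_eq_cube)
  have Taylor: "((\<lambda>\<theta>. ((1 - \<theta>) ^ (3 - 1) / fact (3 - 1)) *\<^sub>R D 3 \<theta>) has_integral
      ln (Z 1) - (\<Sum>i<3. ((1 - 0) ^ i / fact i) *\<^sub>R D i 0)) {0..1}"
  proof (rule Taylor_has_integral)
    fix m :: nat and \<theta> :: real assume "m < 3"
    then have "m = 0 \<or> m = 1 \<or> m = 2" by auto
    moreover have "(D 0 has_real_derivative D 1 \<theta>) (at \<theta>)" "(D 1 has_real_derivative D 2 \<theta>) (at \<theta>)"
      "(D 2 has_real_derivative D 3 \<theta>) (at \<theta>)" using d0 d1 d2 by (simp_all add: D_def)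
    ultimately have "(D m has_real_derivative D (Suc m) \<theta>) (at \<theta>)"
      by (auto simp: numeral_2_eq_2 numeral_3_eq_3)
    then show "(D m has_vector_derivative D (Suc m) \<theta>) (at \<theta> within {0..1})"
      by (metis has_field_derivative_at_within has_real_derivative_iff_has_vector_derivative)
  qed (auto simp: D_def)
  let ?R = "ln (Z 1) - ln (Z 0) - M1 0 / Z 0 - (M2 0 / Z 0 - (M1 0 / Z 0)\<^sup>2) / 2"
  have Taylor': "((\<lambda>\<theta>. (1 - \<theta>)\<^sup>2 / 2 * D3 \<theta>) has_integral ?R) {0..1}"
    using Taylor by (simp add: D_def numeral_3_eq_3 numeral_2_eq_2 algebra_simps)
  define V where "V x \<theta> = 1 + \<bar>u x \<theta>\<bar>" for x \<theta>
  define C where "C \<theta> = (\<Sum>x\<in>B. E x \<theta> * V x \<theta> ^ 3) / Z \<theta>" for \<theta>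
  have V: "1 \<le> V x \<theta>" for x \<theta> by (simp add: V_def)
  \<comment> \<open>The 6 is 1 + 3 + 2, the coefficients in \<open>D3\<close>: each of its three
    quotients is at most \<open>\<rho> ^ 3 * C \<theta>\<close>, a single posterior mean.\<close>
  have D3_bound: "\<bar>D3 \<theta>\<bar> \<le> 6 * \<rho> ^ 3 * C \<theta>" for \<theta>
  proof -
    define S1 where "S1 = (\<Sum>x\<in>B. E x \<theta> * V x \<theta>)"
    define S2 where "S2 = (\<Sum>x\<in>B. E x \<theta> * (V x \<theta>)\<^sup>2)"
    define S3 where "S3 = (\<Sum>x\<in>B. E x \<theta> * V x \<theta> ^ 3)"
    have S: "0 \<le> S1" "0 \<le> S2" "0 \<le> S3" unfolding S1_def S2_def S3_def
      using Epos V by (auto intro!: sum_nonneg mult_nonneg_nonneg simp: less_imp_le order_trans[OF zero_le_one])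
    have w2: "(w x)\<^sup>2 \<le> \<rho>\<^sup>2" and w3: "\<bar>w x\<bar> ^ 3 \<le> \<rho> ^ 3" if "x \<in> B" for x
      using power_mono[OF w[OF that], of 2] power_mono[OF w[OF that], of 3] by auto
    have m1: "\<bar>M1 \<theta>\<bar> \<le> \<rho> * S1"
      unfolding M1_def S1_def sum_distrib_left
    proof (rule order_trans[OF sum_abs], rule sum_mono)
      fix x assume x: "x \<in> B"
      have "\<bar>w x * u x \<theta>\<bar> \<le> \<rho> * V x \<theta>"
        unfolding abs_mult by (rule mult_mono) (use w[OF x] \<rho> in \<open>auto simp: V_def\<close>)
      then show "\<bar>E x \<theta> * - (w x * u x \<theta>)\<bar> \<le> \<rho> * (E x \<theta> * V x \<theta>)"
        using mult_left_mono[of "\<bar>w x * u x \<theta>\<bar>" "\<rho> * V x \<theta>" "E x \<theta>"] Epos[OF x, of \<theta>]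
        by (simp add: abs_mult ac_simps)
    qed
    have m2: "\<bar>M2 \<theta>\<bar> \<le> \<rho>\<^sup>2 * S2"
      unfolding M2_def S2_def sum_distrib_left
    proof (rule order_trans[OF sum_abs], rule sum_mono)
      fix x assume x: "x \<in> B"
      have "\<bar>(w x * u x \<theta>)\<^sup>2 - (w x)\<^sup>2\<bar> = (w x)\<^sup>2 * \<bar>(u x \<theta>)\<^sup>2 - 1\<bar>"
        by (subst abs_mult[of "(w x)\<^sup>2", simplified, symmetric]) (simp add: power_mult_distrib algebra_simps)
      also have "\<dots> \<le> \<rho>\<^sup>2 * (V x \<theta>)\<^sup>2"
        by (rule mult_mono) (use w2[OF x] in \<open>auto simp: V_def power2_eq_square algebra_simps abs_if\<close>)
      finally show "\<bar>E x \<theta> * ((w x * u x \<theta>)\<^sup>2 - (w x)\<^sup>2)\<bar> \<le> \<rho>\<^sup>2 * (E x \<theta> * (V x \<theta>)\<^sup>2)"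
        using mult_left_mono[of "\<bar>(w x * u x \<theta>)\<^sup>2 - (w x)\<^sup>2\<bar>" "\<rho>\<^sup>2 * (V x \<theta>)\<^sup>2" "E x \<theta>"] Epos[OF x, of \<theta>]
        by (simp add: abs_mult ac_simps)
    qed
    have m3: "\<bar>M3 \<theta>\<bar> \<le> \<rho> ^ 3 * S3"
      unfolding M3_def S3_def sum_distrib_left
    proof (rule order_trans[OF sum_abs], rule sum_mono)
      fix x assume x: "x \<in> B"
      have "\<bar>3 * w x ^ 3 * u x \<theta> - (w x * u x \<theta>) ^ 3\<bar> = \<bar>w x\<bar> ^ 3 * \<bar>3 * u x \<theta> - u x \<theta> ^ 3\<bar>"
        by (subst power_abs[symmetric], subst abs_mult[symmetric]) (simp add: power_mult_distrib algebra_simps)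
      also have "\<dots> \<le> \<rho> ^ 3 * V x \<theta> ^ 3"
      proof (rule mult_mono)
        have "\<bar>3 * u x \<theta> - u x \<theta> ^ 3\<bar> \<le> \<bar>3 * u x \<theta>\<bar> + \<bar>u x \<theta> ^ 3\<bar>" by (rule abs_triangle_ineq4)
        also have "\<dots> = 3 * \<bar>u x \<theta>\<bar> + \<bar>u x \<theta>\<bar> ^ 3" by (simp add: power_abs abs_mult)
        also have "\<dots> \<le> V x \<theta> ^ 3" by (simp add: V_def power3_eq_cube algebra_simps)
        finally show "\<bar>3 * u x \<theta> - u x \<theta> ^ 3\<bar> \<le> V x \<theta> ^ 3" .
      qed (use w3[OF x] \<rho> in auto)
      finally show "\<bar>E x \<theta> * (3 * w x ^ 3 * u x \<theta> - (w x * u x \<theta>) ^ 3)\<bar> \<le> \<rho> ^ 3 * (E x \<theta> * V x \<theta> ^ 3)"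
        using mult_left_mono[of "\<bar>3 * w x ^ 3 * u x \<theta> - (w x * u x \<theta>) ^ 3\<bar>" "\<rho> ^ 3 * V x \<theta> ^ 3" "E x \<theta>"] Epos[OF x, of \<theta>]
        by (simp add: abs_mult ac_simps)
    qed
    have c12: "S1 * S2 \<le> Z \<theta> * S3" and c3: "S1 ^ 3 \<le> (Z \<theta>)\<^sup>2 * S3"
      unfolding S1_def S2_def S3_def Z_def
      using Epos V by (auto intro!: weighted_moment_chebyshev weighted_moment_cube
          simp: less_imp_le order_trans[OF zero_le_one])
    let ?z = "Z \<theta>"
    have CS: "C \<theta> = S3 / ?z" by (simp add: C_def S3_def)
    have t1: "\<bar>M3 \<theta> / ?z\<bar> \<le> \<rho> ^ 3 * C \<theta>"
      using m3 Zpos[of \<theta>] by (simp add: C_def S3_def abs_divide divide_right_mono)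
    have "\<bar>M1 \<theta> * M2 \<theta>\<bar> \<le> (\<rho> * S1) * (\<rho>\<^sup>2 * S2)"
      unfolding abs_mult by (rule mult_mono[OF m1 m2]) (use S \<rho> in auto)
    also have "\<dots> = \<rho> ^ 3 * (S1 * S2)" by (simp add: power2_eq_square power3_eq_cube)
    also have "\<dots> \<le> \<rho> ^ 3 * (?z * S3)" using \<rho> c12 by (intro mult_left_mono) auto
    finally have t2: "\<bar>M1 \<theta> * M2 \<theta> / ?z\<^sup>2\<bar> \<le> \<rho> ^ 3 * C \<theta>"
      using Zpos[of \<theta>] by (simp add: CS abs_divide field_simps power2_eq_square)
    have "\<bar>M1 \<theta> ^ 3\<bar> \<le> (\<rho> * S1) ^ 3" unfolding power_abs by (rule power_mono[OF m1]) auto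
    also have "\<dots> = \<rho> ^ 3 * S1 ^ 3" by (simp add: power_mult_distrib)
    also have "\<dots> \<le> \<rho> ^ 3 * (?z\<^sup>2 * S3)" using \<rho> c3 by (intro mult_left_mono) auto
    finally have t3: "\<bar>M1 \<theta> ^ 3 / ?z ^ 3\<bar> \<le> \<rho> ^ 3 * C \<theta>"
      using Zpos[of \<theta>] by (simp add: CS abs_divide field_simps power2_eq_square power3_eq_cube)
    have "D3 \<theta> = M3 \<theta> / ?z - 3 * (M1 \<theta> * M2 \<theta> / ?z\<^sup>2) + 2 * (M1 \<theta> ^ 3 / ?z ^ 3)"
      by (simp add: D3_def)
    then show ?thesis using t1 t2 t3 by linarith
  qed
  \<comment> \<open>Continuity gives integrability in the gauge sense and, together with
    \<open>Cnn\<close>, the passage to a nonnegative Lebesgue integral, the form to which Tonelli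
    applies later.\<close>
  have contC: "continuous_on {0..1} C"
    unfolding C_def Z_def E_def V_def u_def
    by (intro continuous_intros) (use Zpos in \<open>auto simp: Z_def E_def u_def less_imp_neq[symmetric]\<close>)
  then have intC: "((\<lambda>\<theta>. 3 * \<rho> ^ 3 * C \<theta>) has_integral integral {0..1} (\<lambda>\<theta>. 3 * \<rho> ^ 3 * C \<theta>)) {0..1}"
    by (intro integrable_integral integrable_continuous_real continuous_intros)
  have Cnn: "0 \<le> C \<theta>" for \<theta>
    unfolding C_def using Zpos Epos V
    by (auto intro!: sum_nonneg mult_nonneg_nonneg divide_nonneg_nonneg simp: less_imp_le order_trans[OF zero_le_one])
  have "\<bar>?R\<bar> \<le> integral {0..1} (\<lambda>\<theta>. 3 * \<rho> ^ 3 * C \<theta>)"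
  proof -
    have "norm (integral {0..1} (\<lambda>\<theta>. (1 - \<theta>)\<^sup>2 / 2 * D3 \<theta>)) \<le> integral {0..1} (\<lambda>\<theta>. 3 * \<rho> ^ 3 * C \<theta>)"
    proof (rule integral_norm_bound_integral)
      fix \<theta> :: real assume \<theta>: "\<theta> \<in> {0..1}"
      \<comment> \<open>The Taylor kernel is at most 1/2 on the unit interval, which turns the 6
        into the 3 of the statement.\<close>
      then have "(1 - \<theta>)\<^sup>2 \<le> 1" by (intro power_le_one) auto
      then have "(1 - \<theta>)\<^sup>2 / 2 * \<bar>D3 \<theta>\<bar> \<le> 1 / 2 * (6 * \<rho> ^ 3 * C \<theta>)"
        by (intro mult_mono D3_bound) auto
      then show "norm ((1 - \<theta>)\<^sup>2 / 2 * D3 \<theta>) \<le> 3 * \<rho> ^ 3 * C \<theta>" by (simp add: abs_mult ac_simps)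
    qed (use Taylor' intC in \<open>auto simp: has_integral_integrable_integral\<close>)
    then show ?thesis by (simp only: integral_unique[OF Taylor'] real_norm_def)
  qed
  then have "ennreal \<bar>?R\<bar> \<le> ennreal (integral {0..1} (\<lambda>\<theta>. 3 * \<rho> ^ 3 * C \<theta>))"
    by (rule ennreal_leI)
  also have "\<dots> = (\<integral>\<^sup>+\<theta>. ennreal (3 * \<rho> ^ 3 * C \<theta>) * indicator {0..1} \<theta> \<partial>lborel)"
    by (rule nn_integral_has_integral_lebesgue'[OF _ intC, symmetric]) (use Cnn \<rho> in simp)
  finally have main: "ennreal \<bar>?R\<bar> \<le> \<dots>" .
  have "C \<theta> = cubic_moment B q (\<lambda>x. b x + \<theta> * w x)" for \<theta>
    by (simp add: C_def cubic_moment_def gibbs_mean_def gibbs_weight_def Z_def E_def V_def u_def)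
  moreover have "Z 1 = (\<Sum>x\<in>B. gibbs_weight q (\<lambda>x. b x + w x) x)" "Z 0 = (\<Sum>x\<in>B. gibbs_weight q b x)"
    by (simp_all add: Z_def E_def u_def gibbs_weight_def)
  moreover have "M1 0 / Z 0 = - \<alpha>"
    by (simp add: M1_def Z_def \<alpha>_def gibbs_mean_def E_def u_def gibbs_weight_def sum_negf)
  moreover have "M2 0 / Z 0 - (M1 0 / Z 0)\<^sup>2 = \<gamma>"
    by (simp add: M1_def M2_def Z_def \<gamma>_def gibbs_mean_def E_def u_def gibbs_weight_def sum_negf
        power_mult_distrib algebra_simps)
  ultimately show ?thesis using main by simp
qed

section \<open>Gaussian noise vectors\<close>

abbreviation gauss_space :: "'i set \<Rightarrow> ('i \<Rightarrow> real) measure" where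
  "gauss_space I \<equiv> PiM I (\<lambda>_. std_normal_distribution)"

lemma prob_space_std_normal: "prob_space std_normal_distribution"
  by (rule prob_space_normal_density) simp

lemma prob_space_gauss: "prob_space (gauss_space I)"
  by (intro prob_space_PiM prob_space_std_normal)

lemma distr_std_normal_affine:
  assumes "0 < \<sigma>"
  shows "distr std_normal_distribution lborel (\<lambda>z. m + \<sigma> * z) = density lborel (normal_density m \<sigma>)"
proof -
  interpret prob_space std_normal_distribution by (rule prob_space_std_normal)
  have "distributed std_normal_distribution lborel (\<lambda>z. z) (normal_density 0 1)"
    by (auto simp: distributed_def intro!: distr_id2)
  from normal_density_affine[OF this, of \<sigma> m] assms show ?thesis
    by (simp add: distributed_distr_eq_density)
qed

text \<open>Both sides are identified with the product of the one-dimensional laws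
  \<open>density lborel (normal_density (m i) \<sigma>)\<close>, which is determined by its values
  on boxes.\<close>

lemma gauss_affine_density:
  fixes m :: "'i \<Rightarrow> real"
  assumes I: "finite I" and \<sigma>: "0 < \<sigma>"
  shows "distr (gauss_space I) (PiM I (\<lambda>_. borel)) (\<lambda>n. \<lambda>i\<in>I. m i + \<sigma> * n i) =
    density (PiM I (\<lambda>_. lborel)) (\<lambda>y. ennreal (\<Prod>i\<in>I. normal_density (m i) \<sigma> (y i)))"
proof -
  interpret Q: product_sigma_finite "\<lambda>i. density lborel (normal_density (m i) \<sigma>)"
    by (intro product_sigma_finite.intro prob_space_imp_sigma_finite prob_space_normal_density \<sigma>)
  interpret L: product_sigma_finite "\<lambda>i. lborel :: real measure" by standard
  interpret G: product_sigma_finite "\<lambda>i. std_normal_distribution"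
    by (intro product_sigma_finite.intro prob_space_imp_sigma_finite prob_space_std_normal)
  have meas: "(\<lambda>n. \<lambda>i\<in>I. m i + \<sigma> * n i) \<in> gauss_space I \<rightarrow>\<^sub>M PiM I (\<lambda>_. borel)"
    by measurable
  have "distr (gauss_space I) (PiM I (\<lambda>_. borel)) (\<lambda>n. \<lambda>i\<in>I. m i + \<sigma> * n i) =
      PiM I (\<lambda>i. density lborel (normal_density (m i) \<sigma>))"
  proof (rule Q.PiM_eqI[OF I])
    fix A :: "'i \<Rightarrow> real set" assume A: "\<And>i. i \<in> I \<Longrightarrow> A i \<in> sets (density lborel (normal_density (m i) \<sigma>))"
    have "(\<lambda>n. \<lambda>i\<in>I. m i + \<sigma> * n i) -` Pi\<^sub>E I A \<inter> space (gauss_space I) =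
        (\<Pi>\<^sub>E i\<in>I. (\<lambda>z. m i + \<sigma> * z) -` A i)"
      by (auto simp: space_PiM PiE_iff)
    then have "emeasure (distr (gauss_space I) (PiM I (\<lambda>_. borel)) (\<lambda>n. \<lambda>i\<in>I. m i + \<sigma> * n i)) (Pi\<^sub>E I A)
        = emeasure (gauss_space I) (\<Pi>\<^sub>E i\<in>I. (\<lambda>z. m i + \<sigma> * z) -` A i)"
      using A I by (subst emeasure_distr[OF meas]) (auto intro!: sets_PiM_I_finite)
    also have "\<dots> = (\<Prod>i\<in>I. emeasure std_normal_distribution ((\<lambda>z. m i + \<sigma> * z) -` A i))"
      using A by (intro G.emeasure_PiM[OF I]) (auto intro!: measurable_sets_borel[where M=borel] borel_measurable_continuous_onI continuous_intros)
    also have "\<dots> = (\<Prod>i\<in>I. emeasure (density lborel (normal_density (m i) \<sigma>)) (A i))"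
      using A by (intro prod.cong refl)
        (subst distr_std_normal_affine[OF \<sigma>, symmetric], subst emeasure_distr, auto)
    finally show "emeasure (distr (gauss_space I) (PiM I (\<lambda>_. borel)) (\<lambda>n. \<lambda>i\<in>I. m i + \<sigma> * n i)) (Pi\<^sub>E I A)
      = (\<Prod>i\<in>I. emeasure (density lborel (normal_density (m i) \<sigma>)) (A i))" .
  qed (auto intro!: sets_PiM_cong)
  also have "\<dots> = density (PiM I (\<lambda>_. lborel)) (\<lambda>y. ennreal (\<Prod>i\<in>I. normal_density (m i) \<sigma> (y i)))"
  proof (rule Q.PiM_eqI[OF I, symmetric])
    fix A :: "'i \<Rightarrow> real set" assume A: "\<And>i. i \<in> I \<Longrightarrow> A i \<in> sets (density lborel (normal_density (m i) \<sigma>))"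
    have "emeasure (density (PiM I (\<lambda>_. lborel)) (\<lambda>y. ennreal (\<Prod>i\<in>I. normal_density (m i) \<sigma> (y i)))) (Pi\<^sub>E I A)
        = (\<integral>\<^sup>+y. ennreal (\<Prod>i\<in>I. normal_density (m i) \<sigma> (y i)) * indicator (Pi\<^sub>E I A) y \<partial>PiM I (\<lambda>_. lborel))"
      using A I by (intro emeasure_density) (auto intro!: sets_PiM_I_finite)
    also have "\<dots> = (\<integral>\<^sup>+y. (\<Prod>i\<in>I. ennreal (normal_density (m i) \<sigma> (y i)) * indicator (A i) (y i)) \<partial>PiM I (\<lambda>_. lborel))"
    proof (intro nn_integral_cong)
      fix y :: "'i \<Rightarrow> real" assume "y \<in> space (PiM I (\<lambda>_. lborel))"
      then have "indicator (Pi\<^sub>E I A) y = (\<Prod>i\<in>I. indicator (A i) (y i) :: ennreal)"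
        using I by (auto simp: indicator_def space_PiM PiE_iff prod_zero_iff)
      then show "ennreal (\<Prod>i\<in>I. normal_density (m i) \<sigma> (y i)) * indicator (Pi\<^sub>E I A) y =
          (\<Prod>i\<in>I. ennreal (normal_density (m i) \<sigma> (y i)) * indicator (A i) (y i))"
        by (simp add: prod.distrib prod_ennreal)
    qed
    also have "\<dots> = (\<Prod>i\<in>I. \<integral>\<^sup>+z. ennreal (normal_density (m i) \<sigma> z) * indicator (A i) z \<partial>lborel)"
      using A by (intro L.product_nn_integral_prod[OF I]) auto
    also have "\<dots> = (\<Prod>i\<in>I. emeasure (density lborel (normal_density (m i) \<sigma>)) (A i))"
      using A by (intro prod.cong refl) (subst emeasure_density, auto)
    finally show "emeasure (density (PiM I (\<lambda>_. lborel)) (\<lambda>y. ennreal (\<Prod>i\<in>I. normal_density (m i) \<sigma> (y i)))) (Pi\<^sub>E I A)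
      = (\<Prod>i\<in>I. emeasure (density lborel (normal_density (m i) \<sigma>)) (A i))" .
  qed (auto intro!: sets_PiM_cong)
  finally show ?thesis .
qed

text \<open>Makes the output the integration variable in place of the noise; applied with unit noise
  for the posterior identity and with general \<sigma> for the mutual information.\<close>

lemma nn_integral_gauss_affine:
  fixes m :: "'i \<Rightarrow> real"
  assumes I: "finite I" and \<sigma>: "0 < \<sigma>" and F[measurable]: "F \<in> borel_measurable (PiM I (\<lambda>_. borel))"
  shows "(\<integral>\<^sup>+n. F (\<lambda>i\<in>I. m i + \<sigma> * n i) \<partial>gauss_space I) =
    (\<integral>\<^sup>+y. ennreal (\<Prod>i\<in>I. normal_density (m i) \<sigma> (y i)) * F y \<partial>PiM I (\<lambda>_. lborel))"
proof -
  have "sets (PiM I (\<lambda>_. lborel :: real measure)) = sets (PiM I (\<lambda>_. borel))"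
    by (intro sets_PiM_cong) auto
  then have F': "F \<in> borel_measurable (PiM I (\<lambda>_. lborel))"
    using F measurable_cong_sets by blast
  have "(\<integral>\<^sup>+n. F (\<lambda>i\<in>I. m i + \<sigma> * n i) \<partial>gauss_space I) =
      nn_integral (distr (gauss_space I) (PiM I (\<lambda>_. borel)) (\<lambda>n. \<lambda>i\<in>I. m i + \<sigma> * n i)) F"
    by (subst nn_integral_distr) auto
  also have "\<dots> = (\<integral>\<^sup>+y. ennreal (\<Prod>i\<in>I. normal_density (m i) \<sigma> (y i)) * F y \<partial>PiM I (\<lambda>_. lborel))"
    unfolding gauss_affine_density[OF I \<sigma>]
    by (intro nn_integral_density F') auto
  finally show ?thesis .
qed

lemma nn_integral_gauss_component:
  assumes "i \<in> I" "h \<in> borel_measurable borel"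
  shows "(\<integral>\<^sup>+n. h (n i) \<partial>gauss_space I) = (\<integral>\<^sup>+z. h z \<partial>std_normal_distribution)"
proof -
  have "(\<integral>\<^sup>+z. h z \<partial>std_normal_distribution) =
      (\<integral>\<^sup>+z. h z \<partial>distr (gauss_space I) std_normal_distribution (\<lambda>n. n i))"
    by (subst distr_PiM_component) (use assms prob_space_std_normal in auto)
  also have "\<dots> = (\<integral>\<^sup>+n. h (n i) \<partial>gauss_space I)"
    using assms by (subst nn_integral_distr) auto
  finally show ?thesis by simp
qed

section \<open>Posterior averages of the Gaussian channel\<close>

text \<open>The means \<open>m\<close> are measured in units of the noise standard deviation.\<close>

definition residual :: "('a \<Rightarrow> 'i \<Rightarrow> real) \<Rightarrow> 'a \<Rightarrow> ('i \<Rightarrow> real) \<Rightarrow> 'a \<Rightarrow> 'i \<Rightarrow> real" where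
  "residual m x n x' i = m x i - m x' i + n i"

text \<open>The output is \<open>m x i + n i\<close>, so \<open>residual\<close> measures its
  distance from the mean of the candidate \<open>x'\<close>. The Gaussian normalising constant is
  dropped, which keeps the evidence at most 1 and minus its logarithm nonnegative.\<close>

definition likelihood :: "'i set \<Rightarrow> ('a \<Rightarrow> 'i \<Rightarrow> real) \<Rightarrow> 'a \<Rightarrow> ('i \<Rightarrow> real) \<Rightarrow> 'a \<Rightarrow> real" where
  "likelihood I m x n x' = exp (- (\<Sum>i\<in>I. (residual m x n x' i)\<^sup>2) / 2)"

definition evidence :: "'a pmf \<Rightarrow> 'i set \<Rightarrow> ('a \<Rightarrow> 'i \<Rightarrow> real) \<Rightarrow> 'a \<Rightarrow> ('i \<Rightarrow> real) \<Rightarrow> real" where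
  "evidence p I m x n = (\<Sum>x'\<in>set_pmf p. pmf p x' * likelihood I m x n x')"

definition free_entropy :: "'a pmf \<Rightarrow> 'i set \<Rightarrow> ('a \<Rightarrow> 'i \<Rightarrow> real) \<Rightarrow> real" where
  "free_entropy p I m =
    (\<Sum>x\<in>set_pmf p. pmf p x * (\<integral>n. - ln (evidence p I m x n) \<partial>gauss_space I))"

lemma likelihood_pos: "0 < likelihood I m x n x'"
  by (simp add: likelihood_def)

lemma likelihood_le_1: "likelihood I m x n x' \<le> 1"
  by (simp add: likelihood_def sum_nonneg)

lemma evidence_ge:
  assumes "finite (set_pmf p)" "x' \<in> set_pmf p"
  shows "pmf p x' * likelihood I m x n x' \<le> evidence p I m x n"
  unfolding evidence_def using assms
  by (intro member_le_sum) (auto simp: less_imp_le[OF likelihood_pos])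

lemma evidence_pos: "finite (set_pmf p) \<Longrightarrow> 0 < evidence p I m x n"
  unfolding evidence_def using set_pmf_not_empty[of p]
  by (intro sum_pos) (auto simp: likelihood_pos pmf_positive)

lemma evidence_le_1: assumes "finite (set_pmf p)" shows "evidence p I m x n \<le> 1"
proof -
  have "evidence p I m x n \<le> (\<Sum>x'\<in>set_pmf p. pmf p x' * 1)"
    unfolding evidence_def by (intro sum_mono mult_left_mono likelihood_le_1) auto
  then show ?thesis using sum_pmf_eq_1[OF assms, of p] by simp
qed

lemma measurable_residual[measurable]:
  "i \<in> I \<Longrightarrow> (\<lambda>n. residual m x n x' i) \<in> borel_measurable (PiM I (\<lambda>_. borel))"
  unfolding residual_def by measurable

lemma measurable_likelihood[measurable]:
  "(\<lambda>n. likelihood I m x n x') \<in> borel_measurable (PiM I (\<lambda>_. borel))"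
  unfolding likelihood_def by measurable

lemma measurable_evidence[measurable]:
  "(\<lambda>n. evidence p I m x n) \<in> borel_measurable (PiM I (\<lambda>_. borel))"
  unfolding evidence_def by measurable

lemma sets_gauss_space[measurable_cong]: "sets (gauss_space I) = sets (PiM I (\<lambda>_. borel))"
  by (intro sets_PiM_cong) auto

text \<open>A replica drawn from the posterior sees the same residual law as the true input: after the
  change of variables \<open>y = m x + n\<close> the evidence cancels against the mixture density of \<open>y\<close>.\<close>

lemma nishimori:
  fixes h :: "real \<Rightarrow> real" and m :: "'a \<Rightarrow> 'i \<Rightarrow> real"
  assumes fin: "finite (set_pmf p)" and I: "finite I" "i \<in> I"
    and h[measurable]: "h \<in> borel_measurable borel" and h_nonneg: "\<And>z. 0 \<le> h z"
  shows "(\<Sum>x\<in>set_pmf p. ennreal (pmf p x) * (\<integral>\<^sup>+n. ennreal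
      ((\<Sum>x'\<in>set_pmf p. pmf p x' * likelihood I m x n x' * h (residual m x n x' i)) / evidence p I m x n)
        \<partial>gauss_space I)) = (\<integral>\<^sup>+z. ennreal (h z) \<partial>std_normal_distribution)"
proof -
  let ?L = "PiM I (\<lambda>_. lborel :: real measure)"
  \<comment> \<open>\<open>l\<close>, \<open>Z\<close> and \<open>A\<close> are likelihood, evidence
    and posterior numerator as functions of the output alone; the true input no longer appears in
    \<open>Z\<close> and \<open>A\<close>.\<close>
  define l where "l x y = exp (- (\<Sum>i\<in>I. (y i - m x i)\<^sup>2) / 2)" for x y
  define c where "c = (\<Prod>i\<in>I. 1 / sqrt (2 * pi))"
  define Z where "Z y = (\<Sum>x\<in>set_pmf p. pmf p x * l x y)" for y
  define A where "A y = (\<Sum>x\<in>set_pmf p. pmf p x * l x y * h (y i - m x i))" for y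
  have sets_L[measurable_cong]: "sets ?L = sets (PiM I (\<lambda>_. borel))"
    by (intro sets_PiM_cong) auto
  have [measurable]: "l x \<in> borel_measurable (PiM I (\<lambda>_. borel))" for x
    unfolding l_def by measurable
  have [measurable]: "Z \<in> borel_measurable (PiM I (\<lambda>_. borel))"
    unfolding Z_def by measurable
  have [measurable]: "A \<in> borel_measurable (PiM I (\<lambda>_. borel))"
    unfolding A_def using I by measurable
  have density: "(\<Prod>i\<in>I. normal_density (m x i) 1 (y i)) = c * l x y" for x y
    using I by (simp add: normal_density_def c_def l_def prod.distrib prod_dividef sum_negf
        sum_divide_distrib power_one_over flip: exp_sum)
  have c: "0 < c" by (auto simp: c_def intro!: prod_pos)
  have l_pos: "0 < l x y" for x y by (simp add: l_def)
  have Z_pos: "0 < Z y" for y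
    unfolding Z_def using set_pmf_not_empty[of p] fin by (intro sum_pos) (auto simp: l_pos pmf_positive)
  have A_nn: "0 \<le> A y" for y
    unfolding A_def using h_nonneg l_pos by (intro sum_nonneg) (simp add: less_imp_le)
  have shift: "(\<integral>\<^sup>+n. F (\<lambda>i\<in>I. m x i + n i) \<partial>gauss_space I) = (\<integral>\<^sup>+y. ennreal (c * l x y) * F y \<partial>?L)"
    if "F \<in> borel_measurable (PiM I (\<lambda>_. borel))" for F x
    using nn_integral_gauss_affine[OF I(1) _ that, of 1 "m x"] by (simp add: density)
  have lik: "likelihood I m x n x' = l x' (\<lambda>i\<in>I. m x i + n i)" for x n x'
    by (simp add: likelihood_def l_def residual_def algebra_simps)
  then have evd: "evidence p I m x n = Z (\<lambda>i\<in>I. m x i + n i)" for x n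
    by (simp add: evidence_def Z_def)
  have "(\<Sum>x\<in>set_pmf p. ennreal (pmf p x) * (\<integral>\<^sup>+n. ennreal
      ((\<Sum>x'\<in>set_pmf p. pmf p x' * likelihood I m x n x' * h (residual m x n x' i)) / evidence p I m x n)
        \<partial>gauss_space I)) =
      (\<Sum>x\<in>set_pmf p. ennreal (pmf p x) * (\<integral>\<^sup>+n. ennreal (A (\<lambda>i\<in>I. m x i + n i) / Z (\<lambda>i\<in>I. m x i + n i)) \<partial>gauss_space I))"
    using I by (simp add: lik evd A_def residual_def algebra_simps)
  also have "\<dots> = (\<Sum>x\<in>set_pmf p. \<integral>\<^sup>+y. ennreal (pmf p x) * (ennreal (c * l x y) * ennreal (A y / Z y)) \<partial>?L)"
    by (subst shift, measurable) (simp add: nn_integral_cmult)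
  also have "\<dots> = (\<integral>\<^sup>+y. (\<Sum>x\<in>set_pmf p. ennreal (pmf p x) * (ennreal (c * l x y) * ennreal (A y / Z y))) \<partial>?L)"
    by (subst nn_integral_sum) auto
  also have "\<dots> = (\<integral>\<^sup>+y. (\<Sum>x\<in>set_pmf p. ennreal (pmf p x) * (ennreal (c * l x y) * ennreal (h (y i - m x i)))) \<partial>?L)"
  \<comment> \<open>Summing the weights of the true input gives \<open>c * Z y\<close>, which
    cancels the posterior denominator. The numerator \<open>A y\<close> remains, and in it the
    replica takes the place of the true input.\<close>
  proof (intro nn_integral_cong)
    fix y
    have sumZ: "(\<Sum>x\<in>set_pmf p. pmf p x * (c * l x y * d)) = Z y * (c * d)" for d
      unfolding Z_def sum_distrib_right by (intro sum.cong) (simp_all add: ac_simps)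
    have "(\<Sum>x\<in>set_pmf p. ennreal (pmf p x) * (ennreal (c * l x y) * ennreal (A y / Z y))) =
        ennreal (\<Sum>x\<in>set_pmf p. pmf p x * (c * l x y * (A y / Z y)))"
      using c l_pos Z_pos A_nn by (simp add: ennreal_mult'[symmetric] sum_ennreal less_imp_le)
    also have "(\<Sum>x\<in>set_pmf p. pmf p x * (c * l x y * (A y / Z y))) = Z y * (c * (A y / Z y))"
      using sumZ[of "A y / Z y"] .
    also have "\<dots> = (\<Sum>x\<in>set_pmf p. pmf p x * (c * l x y * h (y i - m x i)))"
    proof -
      have "Z y * (c * (A y / Z y)) = c * A y" using Z_pos[of y] by simp
      then show ?thesis by (simp add: A_def sum_distrib_left ac_simps)
    qed
    also have "ennreal \<dots> = (\<Sum>x\<in>set_pmf p. ennreal (pmf p x) * (ennreal (c * l x y) * ennreal (h (y i - m x i))))"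
      using c l_pos h_nonneg by (simp add: ennreal_mult'[symmetric] sum_ennreal less_imp_le)
    finally show "(\<Sum>x\<in>set_pmf p. ennreal (pmf p x) * (ennreal (c * l x y) * ennreal (A y / Z y))) = \<dots>" .
  qed
  also have "\<dots> = (\<Sum>x\<in>set_pmf p. \<integral>\<^sup>+y. ennreal (pmf p x) * (ennreal (c * l x y) * ennreal (h (y i - m x i))) \<partial>?L)"
    using I by (subst nn_integral_sum) auto
  \<comment> \<open>The change of variables is undone with the mean belonging to each term, so that
    \<open>y i - m x i\<close> becomes the pure noise \<open>n i\<close>.\<close>
  also have "\<dots> = (\<Sum>x\<in>set_pmf p. ennreal (pmf p x) * (\<integral>\<^sup>+n. ennreal (h (n i)) \<partial>gauss_space I))"
  proof (intro sum.cong refl)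
    fix x
    have "(\<lambda>y. ennreal (h (y i - m x i))) \<in> borel_measurable (PiM I (\<lambda>_. borel))"
      using I by measurable
    from shift[OF this, of x] show "(\<integral>\<^sup>+y. ennreal (pmf p x) * (ennreal (c * l x y) * ennreal (h (y i - m x i))) \<partial>?L)
        = ennreal (pmf p x) * (\<integral>\<^sup>+n. ennreal (h (n i)) \<partial>gauss_space I)"
      using I by (subst nn_integral_cmult) auto
  qed
  also have "\<dots> = (\<integral>\<^sup>+n. ennreal (h (n i)) \<partial>gauss_space I)"
    using sum_pmf_eq_1[OF fin, of p] by (simp add: sum_distrib_right[symmetric] sum_ennreal)
  also have "\<dots> = (\<integral>\<^sup>+z. ennreal (h z) \<partial>std_normal_distribution)"
    using I by (intro nn_integral_gauss_component) auto
  finally show ?thesis .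
qed

section \<open>Gibbs averages under a cubic envelope\<close>

lemma sum_gibbs_weight_pos:
  assumes "finite B" "B \<noteq> {}" "\<And>x. x \<in> B \<Longrightarrow> 0 < q x"
  shows "0 < (\<Sum>x\<in>B. gibbs_weight q u x)"
  using assms by (intro sum_pos) (auto simp: gibbs_weight_def)

lemma gibbs_mean_cmult: "gibbs_mean B q u (\<lambda>x. c * h x) = c * gibbs_mean B q u h"
  by (simp add: gibbs_mean_def sum_distrib_left ac_simps)

lemma gibbs_mean_abs_le:
  assumes "finite B" "B \<noteq> {}" "\<And>x. x \<in> B \<Longrightarrow> 0 < q x"
    and "\<And>x. x \<in> B \<Longrightarrow> \<bar>h x\<bar> \<le> c * (1 + \<bar>u x\<bar>) ^ 3"
  shows "\<bar>gibbs_mean B q u h\<bar> \<le> c * cubic_moment B q u"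
proof -
  have "\<bar>\<Sum>x\<in>B. gibbs_weight q u x * h x\<bar> \<le> (\<Sum>x\<in>B. gibbs_weight q u x * (c * (1 + \<bar>u x\<bar>) ^ 3))"
  proof (rule order_trans[OF sum_abs], rule sum_mono)
    fix x assume x: "x \<in> B"
    then show "\<bar>gibbs_weight q u x * h x\<bar> \<le> gibbs_weight q u x * (c * (1 + \<bar>u x\<bar>) ^ 3)"
      unfolding abs_mult using assms(3,4)[OF x] by (intro mult_mono) (auto simp: gibbs_weight_def)
  qed
  also have "\<dots> = c * (\<Sum>x\<in>B. gibbs_weight q u x * (1 + \<bar>u x\<bar>) ^ 3)"
    by (simp add: sum_distrib_left ac_simps)
  finally show ?thesis
    using sum_gibbs_weight_pos[of B q u] assms(1-3)
    by (simp add: gibbs_mean_def cubic_moment_def abs_divide divide_right_mono)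
qed

text \<open>Jensen, from Cauchy-Schwarz; it brings the squared mean in the quadratic Taylor
  coefficient under the same cubic envelope.\<close>

lemma gibbs_mean_square_le:
  assumes "finite B" "B \<noteq> {}" "\<And>x. x \<in> B \<Longrightarrow> 0 < q x"
  shows "(gibbs_mean B q u h)\<^sup>2 \<le> gibbs_mean B q u (\<lambda>x. (h x)\<^sup>2)"
proof -
  have "(\<Sum>x\<in>B. gibbs_weight q u x * h x)\<^sup>2 \<le>
      (\<Sum>x\<in>B. gibbs_weight q u x) * (\<Sum>x\<in>B. gibbs_weight q u x * (h x)\<^sup>2)"
    using assms by (intro weighted_moment_cauchy) (auto simp: gibbs_weight_def less_imp_le)
  then show ?thesis using sum_gibbs_weight_pos[of B q u] assms
    by (simp add: gibbs_mean_def field_simps power2_eq_square)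
qed

lemma cubic_moment_nonneg:
  assumes "finite B" "B \<noteq> {}" "\<And>x. x \<in> B \<Longrightarrow> 0 < q x"
  shows "0 \<le> cubic_moment B q u"
  using gibbs_mean_abs_le[of B q "\<lambda>_. 0" 1 u] assms by (simp add: gibbs_mean_def)

section \<open>A priori bounds on the free entropy\<close>

text \<open>Only the term of the true input is kept in the mixture; its residual is the noise
  itself. The resulting majorant does not depend on the means.\<close>

lemma neg_ln_evidence_le:
  assumes "finite (set_pmf p)" "x \<in> set_pmf p"
  shows "- ln (evidence p I m x n) \<le> - ln (pmf p x) + (\<Sum>i\<in>I. (n i)\<^sup>2) / 2"
proof -
  have "pmf p x * likelihood I m x n x \<le> evidence p I m x n" by (rule evidence_ge) fact+
  then have "ln (pmf p x * likelihood I m x n x) \<le> ln (evidence p I m x n)"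
    using assms(2) by (intro ln_mono) (auto simp: likelihood_pos pmf_positive)
  then show ?thesis
    using pmf_positive[OF assms(2)] by (simp add: ln_mult likelihood_def residual_def)
qed

lemma neg_ln_evidence_nonneg: "finite (set_pmf p) \<Longrightarrow> 0 \<le> - ln (evidence p I m x n)"
  using ln_mono[of "evidence p I m x n" 1] evidence_le_1[of p I m x n] evidence_pos[of p I m x n]
  by simp

lemma std_normal_second_moment: "has_bochner_integral std_normal_distribution (\<lambda>z. z\<^sup>2) 1"
  using std_normal_distribution_even_moments[of 1]
  by (simp add: has_bochner_integral_iff power2_eq_square fact_numeral)

lemma has_bochner_integral_gauss_square:
  assumes "i \<in> I"
  shows "has_bochner_integral (gauss_space I) (\<lambda>n. (n i)\<^sup>2) 1"
proof -
  have "has_bochner_integral (distr (gauss_space I) std_normal_distribution (\<lambda>n. n i)) (\<lambda>z. z\<^sup>2) 1"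
    using std_normal_second_moment
    by (subst distr_PiM_component) (use assms prob_space_std_normal in auto)
  then show ?thesis
    using assms by (subst (asm) has_bochner_integral_iff)
      (auto simp: has_bochner_integral_iff integrable_distr_eq integral_distr)
qed

lemma has_bochner_integral_gauss_norm:
  assumes "finite I"
  shows "has_bochner_integral (gauss_space I) (\<lambda>n. (\<Sum>i\<in>I. (n i)\<^sup>2) / 2) (real (card I) / 2)"
proof -
  have "has_bochner_integral (gauss_space I) (\<lambda>n. \<Sum>i\<in>I. (n i)\<^sup>2) (\<Sum>i\<in>I. 1)"
    by (intro has_bochner_integral_sum has_bochner_integral_gauss_square)
  from has_bochner_integral_divide_zero[OF this, of 2] show ?thesis by simp
qed

lemma integrable_neg_ln_evidence:
  assumes "finite (set_pmf p)" "x \<in> set_pmf p" "finite I"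
  shows "integrable (gauss_space I) (\<lambda>n. - ln (evidence p I m x n))"
proof (rule Bochner_Integration.integrable_bound)
  interpret prob_space "gauss_space I" by (rule prob_space_gauss)
  show "integrable (gauss_space I) (\<lambda>n. - ln (pmf p x) + (\<Sum>i\<in>I. (n i)\<^sup>2) / 2)"
    using has_bochner_integral_gauss_norm[OF assms(3)]
    by (intro Bochner_Integration.integrable_add) (auto dest: integrable.intros)
  show "AE n in gauss_space I. norm (- ln (evidence p I m x n)) \<le> norm (- ln (pmf p x) + (\<Sum>i\<in>I. (n i)\<^sup>2) / 2)"
  proof (rule AE_I2)
    fix n
    show "norm (- ln (evidence p I m x n)) \<le> norm (- ln (pmf p x) + (\<Sum>i\<in>I. (n i)\<^sup>2) / 2)"
      using neg_ln_evidence_le[OF assms(1,2), of I m n] neg_ln_evidence_nonneg[OF assms(1), of I m x n]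
      by simp
  qed
qed simp

lemma free_entropy_nonneg: "finite (set_pmf p) \<Longrightarrow> 0 \<le> free_entropy p I m"
  unfolding free_entropy_def
  by (intro sum_nonneg mult_nonneg_nonneg Bochner_Integration.integral_nonneg neg_ln_evidence_nonneg) auto

text \<open>From ln s <= s - 1 at s = 1/t. It bounds one summand of the input entropy.\<close>

lemma neg_mult_ln_le_1:
  fixes t :: real assumes "0 < t" shows "t * (- ln t) \<le> 1"
proof -
  have "- ln t \<le> 1 / t" using ln_le_minus_one[of "1 / t"] assms by (simp add: ln_div)
  then show ?thesis using assms by (simp add: field_simps)
qed

text \<open>Counting inputs is crude but uniform in the means. The bound serves for integrability
  over the spreading matrix and for boundedness of the suprema; the rate of convergence does not
  come from it.\<close>

lemma free_entropy_le:
  assumes "finite (set_pmf p)" "finite I"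
  shows "free_entropy p I m \<le> real (card (set_pmf p)) + real (card I) / 2"
proof -
  interpret prob_space "gauss_space I" by (rule prob_space_gauss)
  have "free_entropy p I m \<le> (\<Sum>x\<in>set_pmf p. 1 + pmf p x * (real (card I) / 2))"
    unfolding free_entropy_def
  proof (rule sum_mono)
    fix x assume x: "x \<in> set_pmf p"
    have *: "has_bochner_integral (gauss_space I) (\<lambda>n. - ln (pmf p x) + (\<Sum>i\<in>I. (n i)\<^sup>2) / 2)
        (- ln (pmf p x) + real (card I) / 2)"
      by (intro has_bochner_integral_add has_bochner_integral_gauss_norm assms)
        (simp add: has_bochner_integral_iff prob_space)
    have "(\<integral>n. - ln (evidence p I m x n) \<partial>gauss_space I) \<le> - ln (pmf p x) + real (card I) / 2"
      unfolding has_bochner_integral_integral_eq[OF *, symmetric]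
      by (intro integral_mono integrable_neg_ln_evidence neg_ln_evidence_le integrable.intros[OF *] assms x)
    then have "pmf p x * (\<integral>n. - ln (evidence p I m x n) \<partial>gauss_space I)
        \<le> pmf p x * (- ln (pmf p x) + real (card I) / 2)"
      by (rule mult_left_mono) simp
    then show "pmf p x * (\<integral>n. - ln (evidence p I m x n) \<partial>gauss_space I) \<le> 1 + pmf p x * (real (card I) / 2)"
      using neg_mult_ln_le_1[of "pmf p x"] x by (simp add: algebra_simps pmf_positive)
  qed
  also have "\<dots> = real (card (set_pmf p)) + real (card I) / 2"
    using sum_pmf_eq_1[OF assms(1), of p] by (simp add: sum.distrib flip: sum_divide_distrib sum_distrib_right)
  finally show ?thesis .
qed

section \<open>Expansion of the free entropy in one spreading coefficient\<close>

text \<open>Models the effect of one coefficient with value \<open>t\<close>: only chip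
  \<open>i\<close> is moved, linearly in \<open>t\<close>, by an amount that depends on the
  input.\<close>

definition shift_means :: "('a \<Rightarrow> 'i \<Rightarrow> real) \<Rightarrow> 'i \<Rightarrow> ('a \<Rightarrow> real) \<Rightarrow> real \<Rightarrow> 'a \<Rightarrow> 'i \<Rightarrow> real" where
  "shift_means m i a t x = (m x)(i := m x i + t * a x)"

text \<open>For each input and noise, \<open>log_partition_taylor\<close> is applied to the residual
  of chip \<open>i\<close>. After averaging, Tonelli isolates each \<theta>, where the shifted means
  form a channel to which \<open>nishimori\<close> applies. The coefficients are chosen before
  \<open>t\<close>, so the expansion can be integrated over any law of the entry.\<close>

lemma free_entropy_taylor:
  fixes m :: "'a \<Rightarrow> 'i \<Rightarrow> real"
  assumes fin: "finite (set_pmf p)" and I: "finite I" "i \<in> I"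
    and a: "\<And>x x'. x \<in> set_pmf p \<Longrightarrow> x' \<in> set_pmf p \<Longrightarrow> \<bar>a x - a x'\<bar> \<le> \<rho>"
    and C: "(\<integral>\<^sup>+z. ennreal ((1 + \<bar>z\<bar>) ^ 3) \<partial>std_normal_distribution) \<le> ennreal C" "0 \<le> C"
  shows "\<exists>\<alpha> \<gamma>. \<forall>t. \<bar>free_entropy p I (shift_means m i a t) - free_entropy p I m - t * \<alpha> - t\<^sup>2 * \<gamma>\<bar>
      \<le> 3 * \<rho> ^ 3 * C * \<bar>t\<bar> ^ 3"
proof -
  let ?B = "set_pmf p" and ?G = "gauss_space I"
  have B: "?B \<noteq> {}" by (rule set_pmf_not_empty)
  have \<rho>: "0 \<le> \<rho>" using B a by (meson abs_ge_zero ex_in_conv order_trans)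
  interpret G: prob_space ?G by (rule prob_space_gauss)
  define q where "q x n x' = pmf p x' * exp (- (\<Sum>j\<in>I - {i}. (residual m x n x' j)\<^sup>2) / 2)" for x n x'
  define b where "b x n x' = residual m x n x' i" for x n x'
  have q: "0 < q x n x'" if "x' \<in> ?B" for x n x' using that by (simp add: q_def pmf_positive)
  \<comment> \<open>True input and candidate are shifted together, so the residual moves by
    \<open>a x - a x'\<close>; this is why the hypothesis bounds differences.\<close>
  have res: "residual (shift_means m i a t) x n x' i = b x n x' + t * (a x - a x')" for t x n x'
    by (simp add: residual_def shift_means_def b_def algebra_simps)
  have lik: "pmf p x' * likelihood I (shift_means m i a t) x n x' =
      gibbs_weight (q x n) (\<lambda>x'. b x n x' + t * (a x - a x')) x'" for t x n x'
  proof -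
    have "(\<Sum>j\<in>I - {i}. (residual (shift_means m i a t) x n x' j)\<^sup>2) = (\<Sum>j\<in>I - {i}. (residual m x n x' j)\<^sup>2)"
      by (intro sum.cong) (auto simp: residual_def shift_means_def)
    then have "(\<Sum>j\<in>I. (residual (shift_means m i a t) x n x' j)\<^sup>2) =
        (b x n x' + t * (a x - a x'))\<^sup>2 + (\<Sum>j\<in>I - {i}. (residual m x n x' j)\<^sup>2)"
      using I by (subst sum.remove[of _ i]) (simp_all add: res)
    then show ?thesis
      by (simp add: likelihood_def q_def gibbs_weight_def add_divide_distrib flip: exp_add)
  qed
  have evd: "evidence p I (shift_means m i a t) x n =
      (\<Sum>x'\<in>?B. gibbs_weight (q x n) (\<lambda>x'. b x n x' + t * (a x - a x')) x')" for t x n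
    by (simp add: evidence_def lik)
  have shift0: "shift_means m i a 0 = m" by (simp add: shift_means_def fun_eq_iff)
  define W where "W t x n = cubic_moment ?B (q x n) (\<lambda>x'. b x n x' + t * (a x - a x'))" for t x n
  have W_nn: "0 \<le> W t x n" for t x n
    unfolding W_def using fin B q by (intro cubic_moment_nonneg) auto
  \<comment> \<open>The cubic moment is a posterior mean of the shifted channel, in exactly the form
    that \<open>nishimori\<close> evaluates.\<close>
  have W_eq: "W t x n = (\<Sum>x'\<in>?B. pmf p x' * likelihood I (shift_means m i a t) x n x' *
        (1 + \<bar>residual (shift_means m i a t) x n x' i\<bar>) ^ 3) / evidence p I (shift_means m i a t) x n" for t x n
    by (simp add: W_def cubic_moment_def gibbs_mean_def evd lik res)
  have meas_b[measurable]: "(\<lambda>n. b x n x') \<in> borel_measurable (PiM I (\<lambda>_. borel))" for x x'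
    unfolding b_def using I by measurable
  have meas_q[measurable]: "(\<lambda>n. q x n x') \<in> borel_measurable (PiM I (\<lambda>_. borel))" for x x'
    unfolding q_def by measurable
  have meas_W[measurable]: "(\<lambda>(n, t). W (t * s) x n) \<in> borel_measurable (PiM I (\<lambda>_. borel) \<Otimes>\<^sub>M borel)" for x s
    unfolding W_def cubic_moment_def gibbs_mean_def gibbs_weight_def by measurable
  have meas_W'[measurable]: "W t x \<in> borel_measurable (PiM I (\<lambda>_. borel))" for x t
    unfolding W_def[abs_def] cubic_moment_def gibbs_mean_def gibbs_weight_def by measurable
  \<comment> \<open>The same \<open>C\<close> serves for all \<open>t\<close>, because the Nishimori
    value does not involve the means.\<close>
  have W_int: "(\<Sum>x\<in>?B. ennreal (pmf p x) * (\<integral>\<^sup>+n. ennreal (W t x n) \<partial>?G)) \<le> ennreal C" for t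
    unfolding W_eq by (subst nishimori[OF fin I]) (use C in auto)
  \<comment> \<open>One term of a finite sum is finite, and its weight \<open>pmf p x\<close> is
    positive on the support.\<close>
  have W_fin: "(\<integral>\<^sup>+n. ennreal (W t x n) \<partial>?G) < \<infinity>" if "x \<in> ?B" for x t
  proof -
    have "ennreal (pmf p x) * (\<integral>\<^sup>+n. ennreal (W t x n) \<partial>?G) \<le>
        (\<Sum>x\<in>?B. ennreal (pmf p x) * (\<integral>\<^sup>+n. ennreal (W t x n) \<partial>?G))"
      using fin that by (intro member_le_sum) auto
    also have "\<dots> \<le> ennreal C" by (rule W_int)
    finally have "ennreal (pmf p x) * (\<integral>\<^sup>+n. ennreal (W t x n) \<partial>?G) < \<infinity>"
      by (simp add: le_less_trans)
    then show ?thesis using that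
      by (auto simp: ennreal_mult_less_top pmf_eq_0_set_pmf)
  qed
  have W_integrable: "integrable ?G (W t x)" if "x \<in> ?B" for x t
    using W_fin[OF that, of t] W_nn by (intro integrableI_nonneg) auto
  define \<alpha> where "\<alpha> x n = gibbs_mean ?B (q x n) (b x n) (\<lambda>x'. (a x - a x') * b x n x')" for x n
  define \<gamma> where "\<gamma> x n = gibbs_mean ?B (q x n) (b x n) (\<lambda>x'. (a x - a x')\<^sup>2 * ((b x n x')\<^sup>2 - 1)) - (\<alpha> x n)\<^sup>2" for x n
  have meas_\<alpha>[measurable]: "\<alpha> x \<in> borel_measurable (PiM I (\<lambda>_. borel))" for x
    unfolding \<alpha>_def[abs_def] gibbs_mean_def gibbs_weight_def by measurable
  have meas_\<gamma>[measurable]: "\<gamma> x \<in> borel_measurable (PiM I (\<lambda>_. borel))" for x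
    unfolding \<gamma>_def[abs_def] gibbs_mean_def gibbs_weight_def by measurable
  have W0: "W 0 x n = cubic_moment ?B (q x n) (b x n)" for x n by (simp add: W_def)
  have cube: "\<bar>z\<bar> \<le> (1 + \<bar>z\<bar>) ^ 3" "\<bar>z\<^sup>2 - 1\<bar> \<le> (1 + \<bar>z\<bar>) ^ 3" "z\<^sup>2 \<le> (1 + \<bar>z\<bar>) ^ 3" for z :: real
  proof -
    have "(1 + \<bar>z\<bar>) ^ 3 = 1 + 3 * \<bar>z\<bar> + 3 * \<bar>z\<bar>\<^sup>2 + \<bar>z\<bar> ^ 3"
      by (simp add: power3_eq_cube power2_eq_square algebra_simps)
    moreover have "0 \<le> \<bar>z\<bar>" "0 \<le> z\<^sup>2" "0 \<le> \<bar>z\<bar> ^ 3" by simp_all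
    ultimately show "\<bar>z\<bar> \<le> (1 + \<bar>z\<bar>) ^ 3" "\<bar>z\<^sup>2 - 1\<bar> \<le> (1 + \<bar>z\<bar>) ^ 3" "z\<^sup>2 \<le> (1 + \<bar>z\<bar>) ^ 3"
      unfolding power2_abs by linarith+
  qed
  have a2: "(a x - a x')\<^sup>2 \<le> \<rho>\<^sup>2" if "x \<in> ?B" "x' \<in> ?B" for x x'
    using power_mono[OF a[OF that], of 2] by simp
  \<comment> \<open>The bounds at displacement 0 on \<alpha> and \<gamma> are there to make both
    coefficients integrable over the noise.\<close>
  have \<alpha>_bound: "\<bar>\<alpha> x n\<bar> \<le> \<rho> * W 0 x n" if x: "x \<in> ?B" for x n
    unfolding W0 \<alpha>_def using fin B q
  proof (rule gibbs_mean_abs_le)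
    fix x' assume "x' \<in> ?B"
    then show "\<bar>(a x - a x') * b x n x'\<bar> \<le> \<rho> * (1 + \<bar>b x n x'\<bar>) ^ 3"
      unfolding abs_mult using a[OF x] cube(1) \<rho> by (intro mult_mono) auto
  qed
  have \<gamma>_bound: "\<bar>\<gamma> x n\<bar> \<le> 2 * \<rho>\<^sup>2 * W 0 x n" if x: "x \<in> ?B" for x n
  proof -
    have "\<bar>gibbs_mean ?B (q x n) (b x n) (\<lambda>x'. (a x - a x')\<^sup>2 * ((b x n x')\<^sup>2 - 1))\<bar> \<le> \<rho>\<^sup>2 * W 0 x n"
      unfolding W0 using fin B q
    proof (rule gibbs_mean_abs_le)
      fix x' assume "x' \<in> ?B"
      then show "\<bar>(a x - a x')\<^sup>2 * ((b x n x')\<^sup>2 - 1)\<bar> \<le> \<rho>\<^sup>2 * (1 + \<bar>b x n x'\<bar>) ^ 3"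
        unfolding abs_mult using a2[OF x] cube(2) by (intro mult_mono) auto
    qed
    moreover have "(\<alpha> x n)\<^sup>2 \<le> \<rho>\<^sup>2 * W 0 x n"
    proof -
      have "(\<alpha> x n)\<^sup>2 \<le> gibbs_mean ?B (q x n) (b x n) (\<lambda>x'. ((a x - a x') * b x n x')\<^sup>2)"
        unfolding \<alpha>_def using fin B q by (rule gibbs_mean_square_le)
      also have "\<dots> \<le> \<bar>\<dots>\<bar>" by simp
      also have "\<dots> \<le> \<rho>\<^sup>2 * W 0 x n"
        unfolding W0 using fin B q
      proof (rule gibbs_mean_abs_le)
        fix x' assume "x' \<in> ?B"
        then show "\<bar>((a x - a x') * b x n x')\<^sup>2\<bar> \<le> \<rho>\<^sup>2 * (1 + \<bar>b x n x'\<bar>) ^ 3"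
          unfolding power_mult_distrib abs_mult using a2[OF x] cube(3) by (intro mult_mono) auto
      qed
      finally show ?thesis .
    qed
    moreover have "0 \<le> (\<alpha> x n)\<^sup>2" by simp
    ultimately show ?thesis unfolding \<gamma>_def by linarith
  qed
  have \<alpha>_int: "integrable ?G (\<alpha> x)" if "x \<in> ?B" for x
    by (rule Bochner_Integration.integrable_bound[OF integrable_mult_right[OF W_integrable[OF that, of 0], of \<rho>]])
      (use \<alpha>_bound[OF that] in \<open>auto intro!: AE_I2 order_trans[OF _ abs_ge_self]\<close>)
  have \<gamma>_int: "integrable ?G (\<gamma> x)" if "x \<in> ?B" for x
    by (rule Bochner_Integration.integrable_bound[OF integrable_mult_right[OF W_integrable[OF that, of 0], of "2 * \<rho>\<^sup>2"]])
      (use \<gamma>_bound[OF that] in \<open>auto intro!: AE_I2 order_trans[OF _ abs_ge_self]\<close>)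
  \<comment> \<open>\<open>log_partition_taylor\<close> expands \<open>ln Z\<close>. For
    \<open>- ln Z\<close> the signs flip: the linear coefficient becomes \<alpha> and the quadratic
    one \<open>- \<gamma> / 2\<close>.\<close>
  define R where "R t x n = - ln (evidence p I (shift_means m i a t) x n) - (- ln (evidence p I m x n))
      - t * \<alpha> x n - t\<^sup>2 * (- \<gamma> x n / 2)" for t x n
  have R_int: "integrable ?G (R t x)" if "x \<in> ?B" for t x
    unfolding R_def[abs_def] using that \<alpha>_int \<gamma>_int
    by (intro Bochner_Integration.integrable_diff integrable_neg_ln_evidence fin I integrable_mult_right
        integrable_divide_zero integrable_minus)
  have R_bound: "ennreal \<bar>R t x n\<bar> \<le>
      (\<integral>\<^sup>+\<theta>. ennreal (3 * (\<rho> * \<bar>t\<bar>) ^ 3 * W (\<theta> * t) x n) * indicator {0..1} \<theta> \<partial>lborel)" if x: "x \<in> ?B" for t x n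
  proof -
    have w: "\<bar>t * (a x - a x')\<bar> \<le> \<rho> * \<bar>t\<bar>" if "x' \<in> ?B" for x'
      using mult_right_mono[OF a[OF x that], of "\<bar>t\<bar>"] by (simp add: abs_mult mult.commute)
    have *: "gibbs_mean ?B (q x n) (b x n) (\<lambda>x'. t * (a x - a x') * b x n x') = t * \<alpha> x n"
      unfolding \<alpha>_def by (simp add: mult.assoc gibbs_mean_cmult)
    have **: "gibbs_mean ?B (q x n) (b x n) (\<lambda>x'. (t * (a x - a x'))\<^sup>2 * ((b x n x')\<^sup>2 - 1)) =
        t\<^sup>2 * gibbs_mean ?B (q x n) (b x n) (\<lambda>x'. (a x - a x')\<^sup>2 * ((b x n x')\<^sup>2 - 1))"
      by (simp add: power_mult_distrib mult.assoc gibbs_mean_cmult)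
    have ev0: "evidence p I m x n = (\<Sum>x'\<in>?B. gibbs_weight (q x n) (b x n) x')"
      using evd[of 0 x n] by (simp add: shift0)
    have "\<bar>R t x n\<bar> = \<bar>ln (\<Sum>x'\<in>?B. gibbs_weight (q x n) (\<lambda>x'. b x n x' + t * (a x - a x')) x')
        - ln (\<Sum>x'\<in>?B. gibbs_weight (q x n) (b x n) x')
        + t * \<alpha> x n - (t\<^sup>2 * gibbs_mean ?B (q x n) (b x n) (\<lambda>x'. (a x - a x')\<^sup>2 * ((b x n x')\<^sup>2 - 1)) - (t * \<alpha> x n)\<^sup>2) / 2\<bar>"
      unfolding R_def evd ev0 \<gamma>_def
      by (subst abs_minus_cancel[symmetric], rule arg_cong[where f=abs])
         (simp add: power_mult_distrib field_simps)
    then show ?thesis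
      using log_partition_taylor[where B="?B" and q="q x n" and b="b x n"
          and w="\<lambda>x'. t * (a x - a x')" and \<rho>="\<rho> * \<bar>t\<bar>"] fin B q w
      unfolding * ** W_def by (simp add: mult.assoc)
  qed
  have total: "(\<Sum>x\<in>?B. ennreal (pmf p x) * (\<integral>\<^sup>+n. ennreal \<bar>R t x n\<bar> \<partial>?G)) \<le> ennreal (3 * \<rho> ^ 3 * C * \<bar>t\<bar> ^ 3)" for t
  proof -
    interpret P: pair_sigma_finite ?G "lborel :: real measure"
      by (intro pair_sigma_finite.intro prob_space_imp_sigma_finite prob_space_gauss sigma_finite_lborel)
    let ?c = "3 * (\<rho> * \<bar>t\<bar>) ^ 3"
    have c: "0 \<le> ?c" using \<rho> by simp
    have "(\<Sum>x\<in>?B. ennreal (pmf p x) * (\<integral>\<^sup>+n. ennreal \<bar>R t x n\<bar> \<partial>?G)) \<le>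
        (\<Sum>x\<in>?B. ennreal (pmf p x) * (\<integral>\<^sup>+n. \<integral>\<^sup>+\<theta>. ennreal (?c * W (\<theta> * t) x n) * indicator {0..1} \<theta> \<partial>lborel \<partial>?G))"
      by (intro sum_mono mult_left_mono nn_integral_mono R_bound) auto
    \<comment> \<open>Tonelli puts \<theta> outermost, so that the noise integral and the sum over
      inputs can act at fixed \<theta>.\<close>
    also have "\<dots> = (\<Sum>x\<in>?B. ennreal (pmf p x) * (\<integral>\<^sup>+\<theta>. \<integral>\<^sup>+n. ennreal (?c * W (\<theta> * t) x n) * indicator {0..1} \<theta> \<partial>?G \<partial>lborel))"
      by (subst P.Fubini') auto
    also have "\<dots> = (\<Sum>x\<in>?B. \<integral>\<^sup>+\<theta>. ennreal ?c * (ennreal (pmf p x) * (\<integral>\<^sup>+n. ennreal (W (\<theta> * t) x n) \<partial>?G)) * indicator {0..1} \<theta> \<partial>lborel)"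
    proof (intro sum.cong refl)
      fix x
      have "(\<integral>\<^sup>+n. ennreal (?c * W (\<theta> * t) x n) * indicator {0..1} \<theta> \<partial>?G) =
          ennreal ?c * (\<integral>\<^sup>+n. ennreal (W (\<theta> * t) x n) \<partial>?G) * indicator {0..1} \<theta>" for \<theta> :: real
        using c W_nn by (simp add: ennreal_mult nn_integral_multc nn_integral_cmult)
      then show "ennreal (pmf p x) * (\<integral>\<^sup>+\<theta>. \<integral>\<^sup>+n. ennreal (?c * W (\<theta> * t) x n) * indicator {0..1} \<theta> \<partial>?G \<partial>lborel) =
         (\<integral>\<^sup>+\<theta>. ennreal ?c * (ennreal (pmf p x) * (\<integral>\<^sup>+n. ennreal (W (\<theta> * t) x n) \<partial>?G)) * indicator {0..1} \<theta> \<partial>lborel)"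
        by (subst nn_integral_cmult[symmetric]) (auto simp: ac_simps intro!: nn_integral_cong)
    qed
    also have "\<dots> = (\<integral>\<^sup>+\<theta>. (\<Sum>x\<in>?B. ennreal ?c * (ennreal (pmf p x) * (\<integral>\<^sup>+n. ennreal (W (\<theta> * t) x n) \<partial>?G)) * indicator {0..1} \<theta>) \<partial>lborel)"
      by (subst nn_integral_sum) auto
    also have "\<dots> \<le> (\<integral>\<^sup>+\<theta>. ennreal (?c * C) * indicator {0..1::real} \<theta> \<partial>lborel)"
    proof (intro nn_integral_mono)
      fix \<theta> :: real
      have "(\<Sum>x\<in>?B. ennreal ?c * (ennreal (pmf p x) * (\<integral>\<^sup>+n. ennreal (W (\<theta> * t) x n) \<partial>?G)) * indicator {0..1} \<theta>) =
          ennreal ?c * (\<Sum>x\<in>?B. ennreal (pmf p x) * (\<integral>\<^sup>+n. ennreal (W (\<theta> * t) x n) \<partial>?G)) * indicator {0..1} \<theta>"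
        by (simp add: sum_distrib_left sum_distrib_right)
      also have "\<dots> \<le> ennreal ?c * ennreal C * indicator {0..1} \<theta>"
        by (intro mult_right_mono mult_left_mono W_int) auto
      finally show "(\<Sum>x\<in>?B. ennreal ?c * (ennreal (pmf p x) * (\<integral>\<^sup>+n. ennreal (W (\<theta> * t) x n) \<partial>?G)) * indicator {0..1} \<theta>)
          \<le> ennreal (?c * C) * indicator {0..1} \<theta>"
        using c C by (simp add: ennreal_mult)
    qed
    also have "\<dots> = ennreal (3 * \<rho> ^ 3 * C * \<bar>t\<bar> ^ 3)"
      by (subst nn_integral_cmult_indicator) (auto simp: power_mult_distrib ac_simps)
    finally show ?thesis .
  qed
  show ?thesis
  proof (intro exI allI)
    fix t
    \<comment> \<open>The witnesses must not contain \<open>t\<close>, although it is already fixed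
      here: they are the averages of the pointwise coefficients.\<close>
    let ?A = "\<Sum>x\<in>?B. pmf p x * (\<integral>n. \<alpha> x n \<partial>?G)"
    let ?g = "\<Sum>x\<in>?B. pmf p x * (\<integral>n. - \<gamma> x n / 2 \<partial>?G)"
    have R_integral: "(\<integral>n. R t x n \<partial>?G) = (\<integral>n. - ln (evidence p I (shift_means m i a t) x n) \<partial>?G)
        - (\<integral>n. - ln (evidence p I m x n) \<partial>?G) - t * (\<integral>n. \<alpha> x n \<partial>?G) - t\<^sup>2 * (\<integral>n. - \<gamma> x n / 2 \<partial>?G)"
      if x: "x \<in> ?B" for x
      unfolding R_def
      by (intro has_bochner_integral_integral_eq has_bochner_integral_diff has_bochner_integral_mult_right
          has_bochner_integral_integrable integrable_neg_ln_evidence fin x I \<alpha>_int \<gamma>_int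
          integrable_divide_zero Bochner_Integration.integrable_minus)
    have "\<bar>free_entropy p I (shift_means m i a t) - free_entropy p I m - t * ?A - t\<^sup>2 * ?g\<bar> =
        \<bar>\<Sum>x\<in>?B. pmf p x * (\<integral>n. R t x n \<partial>?G)\<bar>"
      unfolding free_entropy_def sum_distrib_left sum_subtractf[symmetric]
      by (intro arg_cong[where f=abs] sum.cong refl) (simp only: R_integral right_diff_distrib mult.left_commute)
    also have "\<dots> \<le> (\<Sum>x\<in>?B. pmf p x * (\<integral>n. \<bar>R t x n\<bar> \<partial>?G))"
    proof (rule order_trans[OF sum_abs], rule sum_mono)
      fix x
      show "\<bar>pmf p x * (\<integral>n. R t x n \<partial>?G)\<bar> \<le> pmf p x * (\<integral>n. \<bar>R t x n\<bar> \<partial>?G)"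
        unfolding abs_mult by (intro mult_mono integral_abs_bound) auto
    qed
    also have "\<dots> \<le> 3 * \<rho> ^ 3 * C * \<bar>t\<bar> ^ 3"
    proof -
      have "ennreal (\<Sum>x\<in>?B. pmf p x * (\<integral>n. \<bar>R t x n\<bar> \<partial>?G)) =
          (\<Sum>x\<in>?B. ennreal (pmf p x) * ennreal (\<integral>n. \<bar>R t x n\<bar> \<partial>?G))"
        by (simp add: ennreal_mult'[symmetric] sum_ennreal)
      also have "\<dots> = (\<Sum>x\<in>?B. ennreal (pmf p x) * (\<integral>\<^sup>+n. ennreal \<bar>R t x n\<bar> \<partial>?G))"
        using R_int by (intro sum.cong refl) (subst nn_integral_eq_integral, auto)
      also have "\<dots> \<le> ennreal (3 * \<rho> ^ 3 * C * \<bar>t\<bar> ^ 3)" by (rule total)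
      finally show ?thesis using \<rho> C by (subst (asm) ennreal_le_iff) auto
    qed
    finally show "\<bar>free_entropy p I (shift_means m i a t) - free_entropy p I m - t * ?A - t\<^sup>2 * ?g\<bar>
        \<le> 3 * \<rho> ^ 3 * C * \<bar>t\<bar> ^ 3" .
  qed
qed

section \<open>Lindeberg exchange\<close>

text \<open>Under either law the quadratic polynomial integrates to
  \<open>f\<^sub>0 + v * \<gamma>\<close>, by the common first two moments, so only the cubic
  remainders tell the two integrals apart.\<close>

lemma lindeberg_single:
  fixes f :: "real \<Rightarrow> real"
  assumes "prob_space \<mu>" "prob_space \<nu>"
    and M1: "has_bochner_integral \<mu> (\<lambda>t. t) 0" "has_bochner_integral \<nu> (\<lambda>t. t) 0"
    and M2: "has_bochner_integral \<mu> (\<lambda>t. t\<^sup>2) v" "has_bochner_integral \<nu> (\<lambda>t. t\<^sup>2) v"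
    and M3: "has_bochner_integral \<mu> (\<lambda>t. \<bar>t\<bar> ^ 3) c\<mu>" "has_bochner_integral \<nu> (\<lambda>t. \<bar>t\<bar> ^ 3) c\<nu>"
    and f: "integrable \<mu> f" "integrable \<nu> f"
    and taylor: "\<And>t. \<bar>f t - f\<^sub>0 - t * \<alpha> - t\<^sup>2 * \<gamma>\<bar> \<le> D * \<bar>t\<bar> ^ 3"
  shows "\<bar>integral\<^sup>L \<mu> f - integral\<^sup>L \<nu> f\<bar> \<le> D * (c\<mu> + c\<nu>)"
proof -
  have *: "\<bar>integral\<^sup>L M f - f\<^sub>0 - v * \<gamma>\<bar> \<le> D * c"
    if "prob_space M" "has_bochner_integral M (\<lambda>t. t) 0"
      "has_bochner_integral M (\<lambda>t. t\<^sup>2) v" "has_bochner_integral M (\<lambda>t. \<bar>t\<bar> ^ 3) c" "integrable M f" for M c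
  proof -
    interpret prob_space M by fact
    have P: "has_bochner_integral M (\<lambda>t. f t - f\<^sub>0 - t * \<alpha> - t\<^sup>2 * \<gamma>) (integral\<^sup>L M f - f\<^sub>0 - 0 * \<alpha> - v * \<gamma>)"
      using that
      by (intro has_bochner_integral_diff has_bochner_integral_mult_left)
        (auto simp: has_bochner_integral_iff prob_space)
    have Q: "has_bochner_integral M (\<lambda>t. D * \<bar>t\<bar> ^ 3) (D * c)"
      using that by (intro has_bochner_integral_mult_right) auto
    have "\<bar>integral\<^sup>L M (\<lambda>t. f t - f\<^sub>0 - t * \<alpha> - t\<^sup>2 * \<gamma>)\<bar> \<le> (\<integral>t. \<bar>f t - f\<^sub>0 - t * \<alpha> - t\<^sup>2 * \<gamma>\<bar> \<partial>M)"
      by (rule integral_abs_bound)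
    also have "\<dots> \<le> (\<integral>t. D * \<bar>t\<bar> ^ 3 \<partial>M)"
      using P Q taylor by (intro integral_mono integrable_abs) (auto simp: has_bochner_integral_iff)
    finally show ?thesis
      unfolding has_bochner_integral_integral_eq[OF P] has_bochner_integral_integral_eq[OF Q] by simp
  qed
  show ?thesis
    using *[OF assms(1) M1(1) M2(1) M3(1) f(1)] *[OF assms(2) M1(2) M2(2) M3(2) f(2)]
    by (simp add: distrib_left abs_le_iff)
qed

text \<open>Induction on the index set, with an intermediate law in which the new entry has law
  \<nu> and the old ones still have law \<mu>. \<open>\<Phi>\<close> is generalised because the
  induction hypothesis is used for its slices; the expansion is assumed at every \<open>s\<close> so
  that slices inherit it.\<close>

lemma lindeberg_product:
  fixes \<Phi> :: "('e \<Rightarrow> real) \<Rightarrow> real"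
  assumes prob: "prob_space \<mu>" "prob_space \<nu>" and sets: "sets \<mu> = sets borel" "sets \<nu> = sets borel"
    and M1: "has_bochner_integral \<mu> (\<lambda>t. t) 0" "has_bochner_integral \<nu> (\<lambda>t. t) 0"
    and M2: "has_bochner_integral \<mu> (\<lambda>t. t\<^sup>2) v" "has_bochner_integral \<nu> (\<lambda>t. t\<^sup>2) v"
    and M3: "has_bochner_integral \<mu> (\<lambda>t. \<bar>t\<bar> ^ 3) c\<mu>" "has_bochner_integral \<nu> (\<lambda>t. \<bar>t\<bar> ^ 3) c\<nu>"
    and J: "finite J"
    and \<Phi>: "\<Phi> \<in> borel_measurable (PiM J (\<lambda>_. borel))" "\<And>s. \<bar>\<Phi> s\<bar> \<le> B"
    and taylor: "\<And>e s. e \<in> J \<Longrightarrow> \<exists>\<alpha> \<gamma> f\<^sub>0. \<forall>t. \<bar>\<Phi> (s(e := t)) - f\<^sub>0 - t * \<alpha> - t\<^sup>2 * \<gamma>\<bar> \<le> D * \<bar>t\<bar> ^ 3"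
  shows "\<bar>(\<integral>s. \<Phi> s \<partial>PiM J (\<lambda>_. \<mu>)) - (\<integral>s. \<Phi> s \<partial>PiM J (\<lambda>_. \<nu>))\<bar> \<le> real (card J) * (D * (c\<mu> + c\<nu>))"
  using J \<Phi> taylor
proof (induction J arbitrary: \<Phi> rule: finite_induct)
  case empty
  then show ?case by (simp add: PiM_empty)
next
  case (insert e J)
  interpret \<mu>: prob_space \<mu> by fact
  interpret \<nu>: prob_space \<nu> by fact
  interpret P\<mu>: product_sigma_finite "\<lambda>_. \<mu>" ..
  interpret P\<nu>: product_sigma_finite "\<lambda>_. \<nu>" ..
  interpret J\<mu>: prob_space "PiM J (\<lambda>_. \<mu>)" by (intro prob_space_PiM prob)
  interpret J\<nu>: prob_space "PiM J (\<lambda>_. \<nu>)" by (intro prob_space_PiM prob)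
  interpret I\<mu>: prob_space "PiM (insert e J) (\<lambda>_. \<mu>)" by (intro prob_space_PiM prob)
  interpret I\<nu>: prob_space "PiM (insert e J) (\<lambda>_. \<nu>)" by (intro prob_space_PiM prob)
  interpret pair_sigma_finite "PiM J (\<lambda>_. \<mu>)" \<nu> ..
  have sets_P[measurable_cong]: "sets (PiM K (\<lambda>_. \<mu>)) = sets (PiM K (\<lambda>_. borel))"
    "sets (PiM K (\<lambda>_. \<nu>)) = sets (PiM K (\<lambda>_. borel))" for K :: "'e set"
    by (intro sets_PiM_cong; simp add: sets)+
  note sets[measurable_cong]
  have upd: "(\<lambda>(s, t). s(e := t)) \<in> PiM J (\<lambda>_. borel) \<Otimes>\<^sub>M borel \<rightarrow>\<^sub>M PiM (insert e J) (\<lambda>_. borel :: real measure)"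
    by (rule measurable_add_dim)
  have meas_pair[measurable]: "(\<lambda>(s, t). \<Phi> (s(e := t))) \<in> borel_measurable (PiM J (\<lambda>_. borel) \<Otimes>\<^sub>M borel)"
    using measurable_compose[OF upd insert.prems(1)] by (simp only: split_beta')
  have \<Phi>_slice: "(\<lambda>s. \<Phi> (s(e := t))) \<in> borel_measurable (PiM J (\<lambda>_. borel))" for t
  proof -
    have "(\<lambda>s. (s, t)) \<in> PiM J (\<lambda>_. borel) \<rightarrow>\<^sub>M PiM J (\<lambda>_. borel) \<Otimes>\<^sub>M borel" by measurable
    from measurable_compose[OF this meas_pair] show ?thesis by (simp only: split_conv)
  qed
  note bdd = insert.prems(2)
  have int: "integrable (M1 \<Otimes>\<^sub>M M2) (\<lambda>(s, t). \<Phi> (s(e := t)))"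
    if "prob_space M1" "prob_space M2" and sets': "sets M1 = sets (PiM J (\<lambda>_. borel))" "sets M2 = sets borel" for M1 M2
  proof -
    interpret pair_prob_space M1 M2
      using that by (simp add: pair_prob_space_def pair_sigma_finite_def prob_space_imp_sigma_finite)
    have "(\<lambda>(s, t). \<Phi> (s(e := t))) \<in> borel_measurable (M1 \<Otimes>\<^sub>M M2)"
      using meas_pair measurable_cong_sets[OF sets_pair_measure_cong[OF sets'] refl] by blast
    then show ?thesis by (rule P.integrable_const_bound[where B=B, rotated]) (auto simp: bdd)
  qed
  note int_pair = int[OF J\<mu>.prob_space_axioms \<nu>.prob_space_axioms sets_P(1) sets(2)]
  interpret M: pair_sigma_finite "PiM J (\<lambda>_. \<mu>)" \<mu> ..
  \<comment> \<open>Exchange of the entry \<open>e\<close>, with the others under \<mu>.\<close>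
  have mid: "\<bar>(\<integral>s. \<integral>t. \<Phi> (s(e := t)) \<partial>\<mu> \<partial>PiM J (\<lambda>_. \<mu>)) - (\<integral>s. \<integral>t. \<Phi> (s(e := t)) \<partial>\<nu> \<partial>PiM J (\<lambda>_. \<mu>))\<bar>
      \<le> D * (c\<mu> + c\<nu>)"
  proof -
    have *: "\<bar>(\<integral>t. \<Phi> (s(e := t)) \<partial>\<mu>) - (\<integral>t. \<Phi> (s(e := t)) \<partial>\<nu>)\<bar> \<le> D * (c\<mu> + c\<nu>)"
      if s: "s \<in> space (PiM J (\<lambda>_. \<mu>))" for s
    proof -
      have "\<exists>\<alpha> \<gamma> f\<^sub>0. \<forall>t. \<bar>\<Phi> (s(e := t)) - f\<^sub>0 - t * \<alpha> - t\<^sup>2 * \<gamma>\<bar> \<le> D * \<bar>t\<bar> ^ 3"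
        by (rule insert.prems(3)) simp
      then obtain \<alpha> \<gamma> f\<^sub>0 where taylor: "\<forall>t. \<bar>\<Phi> (s(e := t)) - f\<^sub>0 - t * \<alpha> - t\<^sup>2 * \<gamma>\<bar> \<le> D * \<bar>t\<bar> ^ 3" by blast
      have "s \<in> space (PiM J (\<lambda>_. borel))" using s by (simp only: sets_eq_imp_space_eq[OF sets_P(1)])
      then have "(\<lambda>t. (s, t)) \<in> borel \<rightarrow>\<^sub>M PiM J (\<lambda>_. borel) \<Otimes>\<^sub>M borel" by (rule measurable_Pair1')
      from measurable_compose[OF this meas_pair]
      have slice: "(\<lambda>t. \<Phi> (s(e := t))) \<in> borel_measurable borel" by (simp only: split_conv)
      have "(\<lambda>t. \<Phi> (s(e := t))) \<in> borel_measurable \<mu>" "(\<lambda>t. \<Phi> (s(e := t))) \<in> borel_measurable \<nu>"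
        using slice measurable_cong_sets[OF sets(1) refl] measurable_cong_sets[OF sets(2) refl] by blast+
      then have "integrable \<mu> (\<lambda>t. \<Phi> (s(e := t)))" "integrable \<nu> (\<lambda>t. \<Phi> (s(e := t)))"
        by (auto intro!: \<mu>.integrable_const_bound[where B=B] \<nu>.integrable_const_bound[where B=B] simp: bdd)
      then show ?thesis
        by (intro lindeberg_single[OF prob M1 M2 M3 _ _ taylor[rule_format]])
    qed
    have i1: "integrable (PiM J (\<lambda>_. \<mu>)) (\<lambda>s. \<integral>t. \<Phi> (s(e := t)) \<partial>\<mu>)"
      using M.integrable_fst[OF int[OF J\<mu>.prob_space_axioms \<mu>.prob_space_axioms sets_P(1) sets(1)]] .
    have i2: "integrable (PiM J (\<lambda>_. \<mu>)) (\<lambda>s. \<integral>t. \<Phi> (s(e := t)) \<partial>\<nu>)"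
      using integrable_fst[OF int_pair] .
    have "\<bar>\<integral>s. ((\<integral>t. \<Phi> (s(e := t)) \<partial>\<mu>) - (\<integral>t. \<Phi> (s(e := t)) \<partial>\<nu>)) \<partial>PiM J (\<lambda>_. \<mu>)\<bar> \<le>
        (\<integral>s. \<bar>(\<integral>t. \<Phi> (s(e := t)) \<partial>\<mu>) - (\<integral>t. \<Phi> (s(e := t)) \<partial>\<nu>)\<bar> \<partial>PiM J (\<lambda>_. \<mu>))"
      by (rule integral_abs_bound)
    also have "\<dots> \<le> D * (c\<mu> + c\<nu>)"
      using i1 i2 * by (intro J\<mu>.integral_le_const integrable_abs Bochner_Integration.integrable_diff AE_I2)
    finally show ?thesis using i1 i2 by simp
  qed
  \<comment> \<open>Exchange of the other entries: the induction hypothesis for the slice at each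
    value \<open>t\<close> of entry \<open>e\<close>, then an average over \<open>t\<close> under
    \<nu>.\<close>
  have rest: "\<bar>(\<integral>s. \<integral>t. \<Phi> (s(e := t)) \<partial>\<nu> \<partial>PiM J (\<lambda>_. \<mu>)) - (\<integral>s. \<integral>t. \<Phi> (s(e := t)) \<partial>\<nu> \<partial>PiM J (\<lambda>_. \<nu>))\<bar>
      \<le> real (card J) * (D * (c\<mu> + c\<nu>))"
  proof -
    interpret N: pair_sigma_finite "PiM J (\<lambda>_. \<nu>)" \<nu> ..
    note int_pair' = int[OF J\<nu>.prob_space_axioms \<nu>.prob_space_axioms sets_P(2) sets(2)]
    have IH: "\<bar>(\<integral>s. \<Phi> (s(e := t)) \<partial>PiM J (\<lambda>_. \<mu>)) - (\<integral>s. \<Phi> (s(e := t)) \<partial>PiM J (\<lambda>_. \<nu>))\<bar>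
        \<le> real (card J) * (D * (c\<mu> + c\<nu>))" for t
    proof (rule insert.IH)
      fix e' s assume e': "e' \<in> J"
      then have "e' \<noteq> e" using insert.hyps by auto
      then have swap: "(s(e' := t'))(e := t) = (s(e := t))(e' := t')" for t' by (simp add: fun_upd_twist)
      show "\<exists>\<alpha> \<gamma> f\<^sub>0. \<forall>t'. \<bar>\<Phi> ((s(e' := t'))(e := t)) - f\<^sub>0 - t' * \<alpha> - t'\<^sup>2 * \<gamma>\<bar> \<le> D * \<bar>t'\<bar> ^ 3"
        unfolding swap by (rule insert.prems(3)) (use e' in simp)
    qed (rule \<Phi>_slice, rule bdd)
    have i1: "integrable \<nu> (\<lambda>t. \<integral>s. \<Phi> (s(e := t)) \<partial>PiM J (\<lambda>_. \<mu>))"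
      using integrable_snd[OF int_pair] .
    have i2: "integrable \<nu> (\<lambda>t. \<integral>s. \<Phi> (s(e := t)) \<partial>PiM J (\<lambda>_. \<nu>))"
      using N.integrable_snd[OF int_pair'] .
    have "\<bar>\<integral>t. ((\<integral>s. \<Phi> (s(e := t)) \<partial>PiM J (\<lambda>_. \<mu>)) - (\<integral>s. \<Phi> (s(e := t)) \<partial>PiM J (\<lambda>_. \<nu>))) \<partial>\<nu>\<bar> \<le>
        (\<integral>t. \<bar>(\<integral>s. \<Phi> (s(e := t)) \<partial>PiM J (\<lambda>_. \<mu>)) - (\<integral>s. \<Phi> (s(e := t)) \<partial>PiM J (\<lambda>_. \<nu>))\<bar> \<partial>\<nu>)"
      by (rule integral_abs_bound)
    also have "\<dots> \<le> real (card J) * (D * (c\<mu> + c\<nu>))"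
      using i1 i2 IH by (intro \<nu>.integral_le_const integrable_abs Bochner_Integration.integrable_diff AE_I2)
    finally show ?thesis
      using i1 i2 by (simp add: Fubini_integral[OF int_pair, symmetric] N.Fubini_integral[OF int_pair', symmetric])
  qed
  have eq: "(\<integral>s. \<Phi> s \<partial>PiM (insert e J) (\<lambda>_. \<mu>)) = (\<integral>s. \<integral>t. \<Phi> (s(e := t)) \<partial>\<mu> \<partial>PiM J (\<lambda>_. \<mu>))"
    "(\<integral>s. \<Phi> s \<partial>PiM (insert e J) (\<lambda>_. \<nu>)) = (\<integral>s. \<integral>t. \<Phi> (s(e := t)) \<partial>\<nu> \<partial>PiM J (\<lambda>_. \<nu>))"
    using insert.hyps insert.prems(1) bdd
    by (auto intro!: P\<mu>.product_integral_insert P\<nu>.product_integral_insert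
        I\<mu>.integrable_const_bound[where B=B] I\<nu>.integrable_const_bound[where B=B]
        simp: measurable_cong_sets[OF sets_P(1) refl] measurable_cong_sets[OF sets_P(2) refl])
  have "\<bar>(\<integral>s. \<Phi> s \<partial>PiM (insert e J) (\<lambda>_. \<mu>)) - (\<integral>s. \<Phi> s \<partial>PiM (insert e J) (\<lambda>_. \<nu>))\<bar>
     \<le> D * (c\<mu> + c\<nu>) + real (card J) * (D * (c\<mu> + c\<nu>))"
    unfolding eq using mid rest by linarith
  then show ?case using insert.hyps by (simp add: algebra_simps)
qed

section \<open>Mutual information as free entropy\<close>

lemma nn_integral_pmf_pair:
  assumes "finite (set_pmf p)" "prob_space G" and F: "F \<in> borel_measurable (measure_pmf p \<Otimes>\<^sub>M G)"
  shows "(\<integral>\<^sup>+z. F z \<partial>(measure_pmf p \<Otimes>\<^sub>M G)) = (\<Sum>x\<in>set_pmf p. ennreal (pmf p x) * (\<integral>\<^sup>+n. F (x, n) \<partial>G))"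
proof -
  interpret prob_space G by fact
  show ?thesis
    using assms by (simp add: nn_integral_fst[symmetric] nn_integral_measure_pmf_finite mult.commute)
qed

lemma integral_pmf_pair:
  fixes F :: "'a \<times> 'b \<Rightarrow> real"
  assumes fin: "finite (set_pmf p)" and "prob_space G" and F[measurable]: "F \<in> borel_measurable (measure_pmf p \<Otimes>\<^sub>M G)"
    and int: "\<And>x. x \<in> set_pmf p \<Longrightarrow> integrable G (\<lambda>n. F (x, n))"
  shows "(\<integral>z. F z \<partial>(measure_pmf p \<Otimes>\<^sub>M G)) = (\<Sum>x\<in>set_pmf p. pmf p x * (\<integral>n. F (x, n) \<partial>G))"
proof -
  interpret prob_space G by fact
  interpret pair_sigma_finite "measure_pmf p" G ..
  have "integrable (measure_pmf p \<Otimes>\<^sub>M G) F"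
    using int by (intro Fubini_integrable integrable_measure_pmf_finite fin) (auto simp: AE_measure_pmf_iff)
  then have "(\<integral>z. F z \<partial>(measure_pmf p \<Otimes>\<^sub>M G)) = (\<integral>x. (\<integral>n. F (x, n) \<partial>G) \<partial>measure_pmf p)"
    by (simp add: integral_fst')
  also have "\<dots> = (\<Sum>x\<in>set_pmf p. pmf p x * (\<integral>n. F (x, n) \<partial>G))"
    using fin by (subst integral_measure_pmf_real[of "set_pmf p"]) (auto simp: mult.commute)
  finally show ?thesis .
qed

text \<open>The division by \<sigma> rescales the output to unit noise, the setting of
  \<open>residual\<close> and \<open>free_entropy\<close>.\<close>

definition user_means :: "nat \<Rightarrow> nat \<Rightarrow> real \<Rightarrow> (nat \<times> nat \<Rightarrow> real) \<Rightarrow> (nat \<Rightarrow> real) \<Rightarrow> nat \<Rightarrow> real" where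
  "user_means K N \<sigma> S x i = (\<Sum>k<K. S (i, k) * x k) / sqrt (real N) / \<sigma>"

text \<open>Mutual information is the divergence of the joint law from the product of its marginals,
  whose density is the conditional density of the output over its mixture. In noise variables the
  logarithm of this ratio is minus the log-evidence minus half the squared noise norm, and the
  latter has mean N/2.\<close>

lemma cdma_MI_eq:
  fixes p :: "(nat \<Rightarrow> real) pmf"
  assumes fin: "finite (set_pmf p)" and \<sigma>: "0 < \<sigma>"
  shows "cdma_MI K N \<sigma> (\<lambda>i k. S (i, k)) p = free_entropy p {..<N} (user_means K N \<sigma> S) - real N / 2"
proof -
  let ?I = "{..<N}" and ?P = "measure_pmf p" and ?m = "user_means K N \<sigma> S"
  let ?G = "gauss_space ?I" and ?S = "count_space UNIV :: (nat \<Rightarrow> real) measure"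
  let ?T = "PiM ?I (\<lambda>_. borel) :: (nat \<Rightarrow> real) measure" and ?L = "PiM ?I (\<lambda>_. lborel) :: (nat \<Rightarrow> real) measure"
  let ?B = "set_pmf p"
  define \<mu> where "\<mu> x i = \<sigma> * ?m x i" for x i
  define Y where "Y x n = (\<lambda>i\<in>?I. \<mu> x i + \<sigma> * n i)" for x n
  define \<phi> where "\<phi> x y = (\<Prod>i\<in>?I. normal_density (\<mu> x i) \<sigma> (y i))" for x y
  define D where "D y = (\<Sum>x\<in>?B. pmf p x * \<phi> x y)" for y
  define g where "g = (\<lambda>(x, y). \<phi> x y / D y)"
  let ?M = "?P \<Otimes>\<^sub>M ?G"
  have out: "cdma_output K N \<sigma> (\<lambda>i k. S (i, k)) = (\<lambda>(x, n). Y x n)"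
    using \<sigma> by (auto simp: cdma_output_def Y_def \<mu>_def user_means_def fun_eq_iff restrict_def)
  interpret G: prob_space ?G by (rule prob_space_gauss)
  interpret P: pair_prob_space ?P ?G ..
  have sets_L[measurable_cong]: "sets ?L = sets ?T" by (intro sets_PiM_cong) auto
  have \<mu>_meas[measurable]: "(\<lambda>x. \<mu> x i) \<in> borel_measurable ?S" for i by simp
  have \<phi>_pair[measurable]: "(\<lambda>(x, y). \<phi> x y) \<in> borel_measurable (?S \<Otimes>\<^sub>M ?T)"
    unfolding \<phi>_def normal_density_def by measurable
  have \<phi>_meas[measurable]: "\<phi> x \<in> borel_measurable ?T" for x
    unfolding \<phi>_def[abs_def] by measurable
  have D_meas[measurable]: "D \<in> borel_measurable ?T"
    unfolding D_def[abs_def] by measurable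
  have g_meas[measurable]: "g \<in> borel_measurable (?S \<Otimes>\<^sub>M ?T)"
    unfolding g_def by measurable
  have Y_meas[measurable]: "(\<lambda>(x, n). Y x n) \<in> ?S \<Otimes>\<^sub>M ?G \<rightarrow>\<^sub>M ?T"
    unfolding Y_def by measurable
  have sets_P[measurable_cong]: "sets ?P = sets ?S" by simp
  have \<phi>_pos: "0 < \<phi> x y" for x y
    unfolding \<phi>_def using \<sigma> by (intro prod_pos) (auto simp: normal_density_pos)
  have D_pos: "0 < D y" for y
    unfolding D_def using set_pmf_not_empty[of p] fin \<phi>_pos by (intro sum_pos) (auto simp: pmf_positive)
  have g_pos: "0 < g z" for z by (simp add: g_def \<phi>_pos D_pos split: prod.split)
  have shift: "(\<integral>\<^sup>+n. F (Y x n) \<partial>?G) = (\<integral>\<^sup>+y. ennreal (\<phi> x y) * F y \<partial>?L)"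
    if "F \<in> borel_measurable ?T" for F x
    unfolding Y_def \<phi>_def using that \<sigma> by (intro nn_integral_gauss_affine) auto
  define PY where "PY = distr ?M ?T (\<lambda>(x, n). Y x n)"
  \<comment> \<open>The output law has Lebesgue density \<open>D\<close>, the mixture of the shifted
    Gaussian densities; the fact is stated through integrals.\<close>
  have PY_int: "(\<integral>\<^sup>+y. F y \<partial>PY) = (\<integral>\<^sup>+y. ennreal (D y) * F y \<partial>?L)" if F[measurable]: "F \<in> borel_measurable ?T" for F
  proof -
    have "(\<integral>\<^sup>+y. F y \<partial>PY) = (\<integral>\<^sup>+z. F (case z of (x, n) \<Rightarrow> Y x n) \<partial>?M)"
      unfolding PY_def by (subst nn_integral_distr) auto
    also have "\<dots> = (\<Sum>x\<in>?B. ennreal (pmf p x) * (\<integral>\<^sup>+n. F (Y x n) \<partial>?G))"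
      by (subst nn_integral_pmf_pair[OF fin prob_space_gauss]) auto
    also have "\<dots> = (\<Sum>x\<in>?B. \<integral>\<^sup>+y. ennreal (pmf p x) * (ennreal (\<phi> x y) * F y) \<partial>?L)"
      by (subst shift[OF F]) (simp add: nn_integral_cmult)
    also have "\<dots> = (\<integral>\<^sup>+y. (\<Sum>x\<in>?B. ennreal (pmf p x) * (ennreal (\<phi> x y) * F y)) \<partial>?L)"
      by (subst nn_integral_sum) auto
    also have "\<dots> = (\<integral>\<^sup>+y. ennreal (D y) * F y \<partial>?L)"
    proof (intro nn_integral_cong)
      fix y
      have "ennreal (D y) = (\<Sum>x\<in>?B. ennreal (pmf p x) * ennreal (\<phi> x y))"
        using \<phi>_pos by (simp add: D_def ennreal_mult'[symmetric] sum_ennreal less_imp_le)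
      then show "(\<Sum>x\<in>?B. ennreal (pmf p x) * (ennreal (\<phi> x y) * F y)) = ennreal (D y) * F y"
        by (simp add: sum_distrib_right mult.assoc)
    qed
    finally show ?thesis .
  qed
  have PY: "prob_space PY" unfolding PY_def by (rule P.prob_space_distr) simp
  interpret PY: prob_space PY by (rule PY)
  interpret Q: pair_prob_space ?P PY ..
  have sets_PY[measurable_cong]: "sets PY = sets ?T" by (simp add: PY_def)
  have X: "distr ?M ?S fst = ?P"
  proof -
    have "distr ?M ?S fst = distr ?M ?P fst" by (intro distr_cong) auto
    also have "\<dots> = ?P" by (rule G.distr_pair_fst)
    finally show ?thesis .
  qed
  \<comment> \<open>\<open>D\<close> is everywhere positive, so \<open>\<phi> x y\<close> factors as
    \<open>D y * g (x, y)\<close>: the factor \<open>D\<close> is absorbed by \<open>PY\<close>, and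
    \<open>g\<close> is left as the density.\<close>
  have joint: "distr ?M (?S \<Otimes>\<^sub>M ?T) (\<lambda>z. (fst z, case z of (x, n) \<Rightarrow> Y x n)) = density (?P \<Otimes>\<^sub>M PY) (\<lambda>z. ennreal (g z))"
    (is "?J = ?R")
  proof (rule measure_eqI)
    show sets_eq: "sets ?J = sets ?R"
      unfolding sets_distr sets_density by (intro sets_pair_measure_cong) (simp_all add: sets_PY)
    fix A assume "A \<in> sets ?J"
    then have A[measurable]: "A \<in> sets (?S \<Otimes>\<^sub>M ?T)" by simp
    have Ax[measurable]: "(\<lambda>y. indicator A (x, y) :: ennreal) \<in> borel_measurable ?T" for x by measurable
    have gx[measurable]: "(\<lambda>y. g (x, y)) \<in> borel_measurable ?T" for x by measurable
    have "emeasure ?J A = (\<integral>\<^sup>+z. indicator A z \<partial>?J)" by simp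
    also have "\<dots> = (\<integral>\<^sup>+z. indicator A (fst z, case z of (x, n) \<Rightarrow> Y x n) \<partial>?M)"
      by (rule nn_integral_distr) auto
    also have "\<dots> = (\<Sum>x\<in>?B. ennreal (pmf p x) * (\<integral>\<^sup>+n. indicator A (x, Y x n) \<partial>?G))"
      by (subst nn_integral_pmf_pair[OF fin prob_space_gauss]) auto
    also have "\<dots> = (\<Sum>x\<in>?B. ennreal (pmf p x) * (\<integral>\<^sup>+y. ennreal (\<phi> x y) * indicator A (x, y) \<partial>?L))"
      by (subst shift[OF Ax]) simp
    also have "\<dots> = (\<Sum>x\<in>?B. ennreal (pmf p x) * (\<integral>\<^sup>+y. ennreal (D y) * (ennreal (g (x, y)) * indicator A (x, y)) \<partial>?L))"
    proof -
      have "ennreal (\<phi> x y) = ennreal (D y) * ennreal (g (x, y))" for x y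
        using D_pos[of y] \<phi>_pos[of x y] by (simp add: g_def ennreal_mult'[symmetric])
      then show ?thesis by (simp add: mult.assoc)
    qed
    also have "\<dots> = (\<Sum>x\<in>?B. ennreal (pmf p x) * (\<integral>\<^sup>+y. ennreal (g (x, y)) * indicator A (x, y) \<partial>PY))"
      by (subst PY_int) auto
    also have "\<dots> = (\<integral>\<^sup>+z. ennreal (g z) * indicator A z \<partial>(?P \<Otimes>\<^sub>M PY))"
      by (subst nn_integral_pmf_pair[OF fin PY]) auto
    also have "\<dots> = emeasure ?R A"
      by (subst emeasure_density) auto
    finally show "emeasure ?J A = emeasure ?R A" .
  qed
  have "cdma_MI K N \<sigma> (\<lambda>i k. S (i, k)) p = KL_divergence (exp 1) (?P \<Otimes>\<^sub>M PY) ?J"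
    unfolding cdma_MI_def cdma_space_def out P.mutual_information_def X PY_def[symmetric] by simp
  also have "\<dots> = (\<integral>z. g z * log (exp 1) (g z) \<partial>(?P \<Otimes>\<^sub>M PY))"
    unfolding joint using g_pos by (intro Q.KL_density) (auto simp: less_imp_le)
  \<comment> \<open>One factor \<open>g\<close> is absorbed into the joint law, and base
    \<open>exp 1\<close> makes the logarithm natural.\<close>
  also have "\<dots> = (\<integral>z. ln (g z) \<partial>?J)"
    unfolding joint using g_pos by (subst integral_real_density) (auto simp: less_imp_le log_def)
  also have "\<dots> = (\<integral>z. ln (g (fst z, case z of (x, n) \<Rightarrow> Y x n)) \<partial>?M)"
    by (rule integral_distr) auto
  also have "\<dots> = (\<Sum>x\<in>?B. pmf p x * (\<integral>n. - ln (evidence p ?I ?m x n) \<partial>?G) - pmf p x * (real N / 2))"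
  proof -
    \<comment> \<open>The Gaussian normalising constant, common to numerator and denominator of
      \<open>g\<close>, hence absent from the result.\<close>
    define c where "c = (\<Prod>i\<in>?I. 1 / sqrt (2 * pi * \<sigma>\<^sup>2))"
    have c: "0 < c" unfolding c_def using \<sigma> by (intro prod_pos) auto
    have \<phi>_lik: "\<phi> x' (Y x n) = c * likelihood ?I ?m x n x'" for x x' n
    proof -
      have "normal_density (\<mu> x' i) \<sigma> (Y x n i) = 1 / sqrt (2 * pi * \<sigma>\<^sup>2) * exp (- (residual ?m x n x' i)\<^sup>2 / 2)"
        if "i \<in> ?I" for i
      proof -
        have "Y x n i - \<mu> x' i = \<sigma> * residual ?m x n x' i"
          using that by (simp add: Y_def \<mu>_def residual_def algebra_simps)
        then show ?thesis using \<sigma> by (simp add: normal_density_def power_mult_distrib)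
      qed
      then have "\<phi> x' (Y x n) = (\<Prod>i\<in>?I. 1 / sqrt (2 * pi * \<sigma>\<^sup>2) * exp (- (residual ?m x n x' i)\<^sup>2 / 2))"
        unfolding \<phi>_def by (rule prod.cong[OF refl])
      then show ?thesis
        by (simp only: prod.distrib c_def[symmetric] likelihood_def exp_sum[OF finite_lessThan, symmetric]
            sum_divide_distrib[symmetric] sum_negf)
    qed
    have D_evd: "D (Y x n) = c * evidence p ?I ?m x n" for x n
      by (simp add: D_def evidence_def \<phi>_lik sum_distrib_left ac_simps)
    have ln_g: "ln (g (x, Y x n)) = - ln (evidence p ?I ?m x n) - (\<Sum>i\<in>?I. (n i)\<^sup>2) / 2" for x n
    proof -
      have "g (x, Y x n) = likelihood ?I ?m x n x / evidence p ?I ?m x n"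
        using c by (simp add: g_def \<phi>_lik D_evd)
      then show ?thesis
        using evidence_pos[OF fin, of ?I ?m x n] likelihood_pos[of ?I ?m x n x]
        by (simp add: ln_div) (simp add: likelihood_def residual_def)
    qed
    have hb: "has_bochner_integral ?G (\<lambda>n. ln (g (x, Y x n))) ((\<integral>n. - ln (evidence p ?I ?m x n) \<partial>?G) - real N / 2)"
      if "x \<in> ?B" for x
      unfolding ln_g using has_bochner_integral_gauss_norm[of ?I] that
      by (intro has_bochner_integral_diff has_bochner_integral_integrable integrable_neg_ln_evidence fin) auto
    have "(\<integral>z. ln (g (fst z, case z of (x, n) \<Rightarrow> Y x n)) \<partial>?M) = (\<Sum>x\<in>?B. pmf p x * (\<integral>n. ln (g (x, Y x n)) \<partial>?G))"
      using hb by (subst integral_pmf_pair[OF fin prob_space_gauss]) (auto dest: integrable.intros)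
    also have "\<dots> = (\<Sum>x\<in>?B. pmf p x * (\<integral>n. - ln (evidence p ?I ?m x n) \<partial>?G) - pmf p x * (real N / 2))"
      by (intro sum.cong refl) (simp only: has_bochner_integral_integral_eq[OF hb] right_diff_distrib)
    finally show ?thesis .
  qed
  also have "\<dots> = free_entropy p ?I ?m - real N / 2"
    using sum_pmf_eq_1[OF fin, of p]
    by (simp only: sum_subtractf free_entropy_def sum_distrib_right[symmetric] mult_1)
  finally show ?thesis .
qed

section \<open>Moments of the entry laws\<close>

text \<open>Reflection gives the left tail the mass of the right one.\<close>

lemma symmetric_measure_abs_ge:
  fixes \<mu> :: "real measure"
  assumes "prob_space \<mu>" and sets: "sets \<mu> = sets borel" and sym: "distr \<mu> borel uminus = \<mu>"
  shows "measure \<mu> {s. t \<le> \<bar>s\<bar>} \<le> 2 * measure \<mu> {t..}"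
proof -
  interpret prob_space \<mu> by fact
  note sets[measurable_cong]
  have "measure \<mu> {..-t} = measure (distr \<mu> borel uminus) {..-t}" by (simp only: sym)
  also have "\<dots> = measure \<mu> (uminus -` {..-t} \<inter> space \<mu>)" by (rule measure_distr) auto
  also have "uminus -` {..-t} \<inter> space \<mu> = {t..}" using sets_eq_imp_space_eq[OF sets] by auto
  finally have left: "measure \<mu> {..-t} = measure \<mu> {t..}" .
  have "measure \<mu> {s. t \<le> \<bar>s\<bar>} \<le> measure \<mu> ({t..} \<union> {..-t})"
    by (rule finite_measure_mono) (auto simp: sets abs_if split: if_splits)
  also have "\<dots> \<le> measure \<mu> {t..} + measure \<mu> {..-t}"
    by (rule measure_Un_le) (auto simp: sets)
  finally show ?thesis using left by simp
qed

text \<open>Cutting at integer levels: with n the integer part of |s|, |s|^3 is at most (n + 1)^3,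
  which is one term of a series of weighted indicators of {|s| >= n}. The series of their integrals
  converges by the tail bound.\<close>

lemma assumption_A_third_moment:
  assumes "assumption_A \<mu>"
  shows "integrable \<mu> (\<lambda>s. \<bar>s\<bar> ^ 3)"
proof -
  obtain s0 A where prob: "prob_space \<mu>" and sets: "sets \<mu> = sets borel" and sym: "distr \<mu> borel uminus = \<mu>"
    and pos: "0 < A" and tail: "\<And>s. s \<ge> s0 \<Longrightarrow> measure \<mu> {s..} \<le> exp (- A * s\<^sup>2)"
    using assms unfolding assumption_A_def by blast
  interpret prob_space \<mu> by fact
  note sets[measurable_cong]
  let ?E = "\<lambda>n::nat. {s::real. real n \<le> \<bar>s\<bar>}"
  have [measurable]: "?E n \<in> sets borel" for n by measurable
  have summable: "summable (\<lambda>n. real (Suc n) ^ 3 * measure \<mu> (?E n))"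
  proof (rule summable_comparison_test_ev)
    show "\<forall>\<^sub>F n in sequentially. norm (real (Suc n) ^ 3 * measure \<mu> (?E n)) \<le> 2 * (real (Suc n) ^ 3 * exp (- A * real n))"
      \<comment> \<open>The tail bound holds from \<open>s0\<close> on, and summability ignores
        finitely many terms. The Gaussian exponent is weakened to a linear one.\<close>
      using eventually_ge_at_top[of "nat \<lceil>s0\<rceil>"]
    proof eventually_elim
      case (elim n)
      then have "measure \<mu> {real n..} \<le> exp (- A * (real n)\<^sup>2)" by (intro tail) linarith
      also have "\<dots> \<le> exp (- A * real n)"
      proof -
        have "real n \<le> (real n)\<^sup>2" by (cases n) (auto simp: power2_eq_square)
        then show ?thesis using pos by simp
      qed
      finally have "measure \<mu> (?E n) \<le> 2 * exp (- A * real n)"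
        using symmetric_measure_abs_ge[OF prob sets sym, of "real n"] by linarith
      then have "real (Suc n) ^ 3 * measure \<mu> (?E n) \<le> real (Suc n) ^ 3 * (2 * exp (- A * real n))"
        by (intro mult_left_mono) auto
      then show ?case by (simp add: ac_simps)
    qed
    have "summable (\<lambda>n. real (Suc n) ^ 3 * exp (- A * real n))"
    proof (rule summable_comparison_test_bigo)
      show "summable (\<lambda>n. norm (1 / real n ^ 2))"
        using inverse_power_summable[of 2, where ?'a=real] by (simp add: inverse_eq_divide)
      show "(\<lambda>n. real (Suc n) ^ 3 * exp (- A * real n)) \<in> O(\<lambda>n. 1 / real n ^ 2)"
        using pos by real_asymp
    qed
    then show "summable (\<lambda>n. 2 * (real (Suc n) ^ 3 * exp (- A * real n)))" by (rule summable_mult)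
  qed
  have "(\<integral>\<^sup>+s. ennreal (norm (\<bar>s\<bar> ^ 3)) \<partial>\<mu>) \<le> (\<integral>\<^sup>+s. (\<Sum>n. ennreal (real (Suc n) ^ 3) * indicator (?E n) s) \<partial>\<mu>)"
  proof (intro nn_integral_mono)
    fix s :: real
    define n where "n = nat \<lfloor>\<bar>s\<bar>\<rfloor>"
    have n: "real n \<le> \<bar>s\<bar>" "\<bar>s\<bar> \<le> real (Suc n)" unfolding n_def by linarith+
    have "ennreal (norm (\<bar>s\<bar> ^ 3)) \<le> ennreal (real (Suc n) ^ 3) * indicator (?E n) s"
      using n power_mono[OF n(2), of 3] by (simp add: ennreal_leI)
    also have "\<dots> \<le> (\<Sum>n. ennreal (real (Suc n) ^ 3) * indicator (?E n) s)"
    proof -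
      define f :: "nat \<Rightarrow> ennreal" where "f k = ennreal (real (Suc k) ^ 3) * indicator (?E k) s" for k
      have "sum f {n} \<le> suminf f" by (rule sum_le_suminf) auto
      then have "f n \<le> suminf f" by simp
      then show ?thesis unfolding f_def .
    qed
    finally show "ennreal (norm (\<bar>s\<bar> ^ 3)) \<le> (\<Sum>n. ennreal (real (Suc n) ^ 3) * indicator (?E n) s)" .
  qed
  also have "\<dots> = (\<Sum>n. ennreal (real (Suc n) ^ 3) * emeasure \<mu> (?E n))"
    by (subst nn_integral_suminf) (auto simp: nn_integral_cmult_indicator sets)
  also have "\<dots> = (\<Sum>n. ennreal (real (Suc n) ^ 3 * measure \<mu> (?E n)))"
    by (simp add: emeasure_eq_measure ennreal_mult'[symmetric])
  also have "\<dots> = ennreal (\<Sum>n. real (Suc n) ^ 3 * measure \<mu> (?E n))"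
    by (rule suminf_ennreal2[OF _ summable]) (intro mult_nonneg_nonneg zero_le_power of_nat_0_le_iff measure_nonneg)
  also have "\<dots> < \<infinity>" by simp
  finally show ?thesis by (intro integrableI_bounded) auto
qed

text \<open>The integral equals its own negative; integrability comes from |s| <= 1 + s^2.\<close>

lemma symmetric_mean_zero:
  assumes "prob_space \<mu>" and sets: "sets \<mu> = sets borel" and sym: "distr \<mu> borel uminus = \<mu>"
    and sq: "integrable \<mu> (\<lambda>s. s\<^sup>2)"
  shows "has_bochner_integral \<mu> (\<lambda>s. s) (0::real)"
proof -
  interpret prob_space \<mu> by fact
  note sets[measurable_cong]
  have int: "integrable \<mu> (\<lambda>s. s)"
  proof (rule Bochner_Integration.integrable_bound)
    show "integrable \<mu> (\<lambda>s. 1 + s\<^sup>2)" using sq by simp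
    have "\<bar>s\<bar> \<le> 1 + s\<^sup>2" for s :: real
    proof -
      have "0 \<le> (\<bar>s\<bar> - 1)\<^sup>2" "0 \<le> \<bar>s\<bar>" by auto
      then show ?thesis unfolding power2_diff power2_abs by simp
    qed
    then show "AE s in \<mu>. norm s \<le> norm (1 + s\<^sup>2)" by (simp add: abs_of_nonneg)
  qed simp
  have "(\<integral>s. s \<partial>\<mu>) = (\<integral>s. s \<partial>distr \<mu> borel uminus)" by (simp only: sym)
  also have "\<dots> = (\<integral>s. - s \<partial>\<mu>)" by (rule integral_distr) auto
  finally have "(\<integral>s. s \<partial>\<mu>) = 0" by simp
  then show ?thesis using int by (simp add: has_bochner_integral_iff)
qed

lemma integrable_std_normal_abs_moment: "integrable std_normal_distribution (\<lambda>z. \<bar>z\<bar> ^ k)"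
  using integrable_std_normal_moment_abs[of k] by (subst integrable_real_density) auto

lemma std_normal_mean_zero: "has_bochner_integral std_normal_distribution (\<lambda>z. z) 0"
  using integral_std_normal_distribution_moment_odd[of 1] integrable_std_normal_distribution_moment[of 1]
  by (simp add: has_bochner_integral_iff)

text \<open>Each supremum is at most the other plus \<open>d\<close>, without appeal to a maximiser.
  Boundedness matters because a real \<open>SUP\<close> is an upper bound only for bounded
  families.\<close>

lemma abs_SUP_diff_le:
  fixes f g :: "'a \<Rightarrow> real"
  assumes "P \<noteq> {}" "bdd_above (f ` P)" "bdd_above (g ` P)" "\<And>p. p \<in> P \<Longrightarrow> \<bar>f p - g p\<bar> \<le> d"
  shows "\<bar>(SUP p\<in>P. f p) - (SUP p\<in>P. g p)\<bar> \<le> d"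
proof -
  have "(SUP p\<in>P. f p) \<le> (SUP p\<in>P. g p) + d"
  proof (rule cSUP_least[OF assms(1)])
    fix p assume p: "p \<in> P"
    show "f p \<le> (SUP p\<in>P. g p) + d"
      using cSUP_upper[OF p assms(3)] assms(4)[OF p] by linarith
  qed
  moreover have "(SUP p\<in>P. g p) \<le> (SUP p\<in>P. f p) + d"
  proof (rule cSUP_least[OF assms(1)])
    fix p assume p: "p \<in> P"
    show "g p \<le> (SUP p\<in>P. f p) + d"
      using cSUP_upper[OF p assms(2)] assms(4)[OF p] by linarith
  qed
  ultimately show ?thesis by linarith
qed

section \<open>Exchanging the spreading law\<close>

lemma finite_bin_inputs: "finite (bin_inputs K)"
proof -
  have "bin_inputs K = {x. \<forall>i. (i \<in> {..<K} \<longrightarrow> x i \<in> {-1, 1}) \<and> (i \<notin> {..<K} \<longrightarrow> x i = 0)}"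
    by (auto simp: bin_inputs_def not_less)
  then show ?thesis by (simp only: finite_set_of_finite_funs finite_lessThan finite.intros)
qed

lemma abs_diff_bin_inputs_le:
  assumes "x \<in> bin_inputs K" "x' \<in> bin_inputs K"
  shows "\<bar>x k - x' k\<bar> \<le> 2"
proof -
  have "x k \<in> {-1, 0, 1}" "x' k \<in> {-1, 0, 1}"
    using assms by (cases "k < K"; auto simp: bin_inputs_def)+
  then show ?thesis by auto
qed

text \<open>The base point has the entry set to 0, so it is free of \<open>t\<close>, and what
  remains is linear in \<open>t\<close>. This is the link between the entrywise exchange and
  \<open>free_entropy_taylor\<close>.\<close>

lemma user_means_update:
  assumes "k < K"
  shows "user_means K N \<sigma> (S((i, k) := t)) =
    shift_means (user_means K N \<sigma> (S((i, k) := 0))) i (\<lambda>x. x k / sqrt (real N) / \<sigma>) t"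
proof (intro ext)
  fix x j
  have "(\<Sum>k'<K. (S((i, k) := t)) (i, k') * x k') = (\<Sum>k'<K. (S((i, k) := 0)) (i, k') * x k') + t * x k"
    using assms by (simp add: sum.remove[of "{..<K}" k])
  then show "user_means K N \<sigma> (S((i, k) := t)) x j =
      shift_means (user_means K N \<sigma> (S((i, k) := 0))) i (\<lambda>x. x k / sqrt (real N) / \<sigma>) t x j"
    by (cases "j = i") (simp_all add: user_means_def shift_means_def add_divide_distrib)
qed

lemma measurable_free_entropy_user_means:
  "(\<lambda>S. free_entropy p {..<N} (user_means K N \<sigma> S)) \<in> borel_measurable (PiM ({..<N} \<times> {..<K}) (\<lambda>_. borel))"
proof -
  interpret G: prob_space "gauss_space {..<N}" by (rule prob_space_gauss)
  have "(\<lambda>(S, n). - ln (evidence p {..<N} (user_means K N \<sigma> S) x n)) \<in>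
      borel_measurable (PiM ({..<N} \<times> {..<K}) (\<lambda>_. borel) \<Otimes>\<^sub>M gauss_space {..<N})" for x
    unfolding evidence_def likelihood_def residual_def user_means_def by measurable
  then show ?thesis
    unfolding free_entropy_def by (intro borel_measurable_sum borel_measurable_times borel_measurable_const
        G.borel_measurable_lebesgue_integral)
qed

text \<open>The constant 24 is 3 * 2^3: the 3 of the Taylor bound times the cube of the largest
  change of a binary coordinate.\<close>

lemma capacity_swap:
  fixes \<mu> :: "real measure"
  assumes prob: "prob_space \<mu>" and sets: "sets \<mu> = sets borel"
    and M1: "has_bochner_integral \<mu> (\<lambda>t. t) 0" and M2: "has_bochner_integral \<mu> (\<lambda>t. t\<^sup>2) 1"
    and M3: "has_bochner_integral \<mu> (\<lambda>t. \<bar>t\<bar> ^ 3) c\<mu>"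
    and G3: "has_bochner_integral std_normal_distribution (\<lambda>t. \<bar>t\<bar> ^ 3) cg"
    and C: "(\<integral>\<^sup>+z. ennreal ((1 + \<bar>z\<bar>) ^ 3) \<partial>std_normal_distribution) \<le> ennreal C" "0 \<le> C"
    and K: "0 < K" and N: "0 < N" and \<sigma>: "0 < \<sigma>"
  shows "\<bar>cdma_capacity \<mu> K N \<sigma> - cdma_capacity std_normal_distribution K N \<sigma>\<bar>
    \<le> 24 / \<sigma> ^ 3 * C * (c\<mu> + cg) / sqrt (real N)"
proof -
  let ?P = "{p. set_pmf p \<subseteq> bin_inputs K}" and ?J = "{..<N} \<times> {..<K}" and ?\<nu> = std_normal_distribution
  define \<Phi> where "\<Phi> p S = free_entropy p {..<N} (user_means K N \<sigma> S)" for p S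
  define B where "B = real (card (bin_inputs K)) + real N / 2"
  \<comment> \<open>Two inputs differ by at most 2 in one coordinate; the divisor is the chip
    normalisation times the noise level.\<close>
  define \<rho> where "\<rho> = 2 / (sqrt (real N) * \<sigma>)"
  have fin: "finite (set_pmf p)" if "p \<in> ?P" for p
    using that finite_bin_inputs finite_subset by blast
  have bound: "0 \<le> \<Phi> p S" "\<Phi> p S \<le> B" if "p \<in> ?P" for p S
  proof -
    have "card (set_pmf p) \<le> card (bin_inputs K)"
      using that finite_bin_inputs by (intro card_mono) auto
    then show "0 \<le> \<Phi> p S" "\<Phi> p S \<le> B"
      using free_entropy_nonneg[OF fin[OF that], of "{..<N}" "user_means K N \<sigma> S"]
        free_entropy_le[OF fin[OF that], of "{..<N}" "user_means K N \<sigma> S"]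
      by (simp_all add: \<Phi>_def B_def)
  qed
  have \<Phi>_meas: "\<Phi> p \<in> borel_measurable (PiM ?J (\<lambda>_. borel))" for p
    unfolding \<Phi>_def[abs_def] by (rule measurable_free_entropy_user_means)
  have \<Phi>_int: "integrable (PiM ?J (\<lambda>_. M)) (\<Phi> p)"
    if "p \<in> ?P" "prob_space M" "sets M = sets borel" for p M
  proof -
    interpret prob_space "PiM ?J (\<lambda>_. M)" by (intro prob_space_PiM that)
    have "sets (PiM ?J (\<lambda>_. M)) = sets (PiM ?J (\<lambda>_. borel))" by (intro sets_PiM_cong) (auto simp: that)
    then have "\<Phi> p \<in> borel_measurable (PiM ?J (\<lambda>_. M))" using \<Phi>_meas measurable_cong_sets by blast
    then show ?thesis using bound[OF that(1)]
      by (intro integrable_const_bound[where B=B]) (auto simp: abs_of_nonneg)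
  qed
  \<comment> \<open>The offset N/2 is the same for every entry law, so it disappears from the
    difference of two mutual informations.\<close>
  have MI: "(\<integral>S. cdma_MI K N \<sigma> (\<lambda>i k. S (i, k)) p \<partial>spreading_law K N M) = (\<integral>S. \<Phi> p S \<partial>PiM ?J (\<lambda>_. M)) - real N / 2"
    if "p \<in> ?P" "prob_space M" "sets M = sets borel" for p M
  proof -
    interpret prob_space "PiM ?J (\<lambda>_. M)" by (intro prob_space_PiM that)
    have "(\<integral>S. cdma_MI K N \<sigma> (\<lambda>i k. S (i, k)) p \<partial>spreading_law K N M) =
        (\<integral>S. \<Phi> p S - real N / 2 \<partial>PiM ?J (\<lambda>_. M))"
      by (simp add: spreading_law_def cdma_MI_eq[OF fin[OF that(1)] \<sigma>] \<Phi>_def)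
    then show ?thesis using \<Phi>_int[OF that] by (simp add: prob_space)
  qed
  define F where "F M p = (\<integral>S. cdma_MI K N \<sigma> (\<lambda>i k. S (i, k)) p \<partial>spreading_law K N M)" for M p
  have close: "\<bar>F \<mu> p - F ?\<nu> p\<bar> \<le> real (N * K) * (3 * \<rho> ^ 3 * C * (c\<mu> + cg))" if p: "p \<in> ?P" for p
  proof -
    have "\<bar>(\<integral>S. \<Phi> p S \<partial>PiM ?J (\<lambda>_. \<mu>)) - (\<integral>S. \<Phi> p S \<partial>PiM ?J (\<lambda>_. ?\<nu>))\<bar>
        \<le> real (card ?J) * (3 * \<rho> ^ 3 * C * (c\<mu> + cg))"
    proof (rule lindeberg_product[OF prob prob_space_std_normal sets _ M1 std_normal_mean_zero M2
          std_normal_second_moment M3 G3])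
      fix e s assume "e \<in> ?J"
      then obtain i k where e: "e = (i, k)" and i: "i \<in> {..<N}" and k: "k < K" by auto
      let ?a = "\<lambda>x :: nat \<Rightarrow> real. x k / sqrt (real N) / \<sigma>"
      have a: "\<bar>?a x - ?a x'\<bar> \<le> \<rho>" if "x \<in> set_pmf p" "x' \<in> set_pmf p" for x x'
      proof -
        have "?a x - ?a x' = (x k - x' k) / (sqrt (real N) * \<sigma>)" by (simp add: diff_divide_distrib)
        then have "\<bar>?a x - ?a x'\<bar> = \<bar>x k - x' k\<bar> / (sqrt (real N) * \<sigma>)" using \<sigma> by (simp add: abs_mult)
        also have "\<dots> \<le> \<rho>" unfolding \<rho>_def
          using p that \<sigma> by (intro divide_right_mono abs_diff_bin_inputs_le) auto
        finally show ?thesis .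
      qed
      show "\<exists>\<alpha> \<gamma> f\<^sub>0. \<forall>t. \<bar>\<Phi> p (s(e := t)) - f\<^sub>0 - t * \<alpha> - t\<^sup>2 * \<gamma>\<bar> \<le> 3 * \<rho> ^ 3 * C * \<bar>t\<bar> ^ 3"
      proof -
        have "\<exists>\<alpha> \<gamma>. \<forall>t. \<bar>free_entropy p {..<N} (shift_means (user_means K N \<sigma> (s(e := 0))) i ?a t)
            - free_entropy p {..<N} (user_means K N \<sigma> (s(e := 0))) - t * \<alpha> - t\<^sup>2 * \<gamma>\<bar> \<le> 3 * \<rho> ^ 3 * C * \<bar>t\<bar> ^ 3"
          by (rule free_entropy_taylor) (use fin[OF p] i a C in auto)
        then obtain \<alpha> \<gamma> where "\<forall>t. \<bar>\<Phi> p (s(e := t)) - \<Phi> p (s(e := 0)) - t * \<alpha> - t\<^sup>2 * \<gamma>\<bar> \<le> 3 * \<rho> ^ 3 * C * \<bar>t\<bar> ^ 3"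
          unfolding \<Phi>_def e user_means_update[OF k, of N \<sigma> s i, symmetric] by (elim exE)
        then show ?thesis by (intro exI)
      qed
    qed (use \<Phi>_meas bound[OF p] in \<open>auto simp: abs_of_nonneg\<close>)
    then show ?thesis
      using p by (simp add: F_def MI prob sets prob_space_std_normal card_cartesian_product)
  qed
  have bdd: "bdd_above (F M ` ?P)" if "prob_space M" "sets M = sets borel" for M
  proof (rule bdd_aboveI2)
    fix p assume p: "p \<in> ?P"
    interpret prob_space "PiM ?J (\<lambda>_. M)" by (intro prob_space_PiM that)
    have "(\<integral>S. \<Phi> p S \<partial>PiM ?J (\<lambda>_. M)) \<le> B"
      using bound[OF p] by (intro integral_le_const \<Phi>_int p that) auto
    then show "F M p \<le> B - real N / 2" by (simp add: F_def MI[OF p that])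
  qed
  \<comment> \<open>All users send 1, and the coordinates beyond the users are 0 as
    \<open>bin_inputs\<close> demands.\<close>
  have "return_pmf (\<lambda>i. if i < K then 1 else 0) \<in> ?P" by (auto simp: bin_inputs_def)
  then have "?P \<noteq> {}" by blast
  then have "\<bar>(SUP p\<in>?P. F \<mu> p) - (SUP p\<in>?P. F ?\<nu> p)\<bar> \<le> real (N * K) * (3 * \<rho> ^ 3 * C * (c\<mu> + cg))"
    by (intro abs_SUP_diff_le bdd prob sets prob_space_std_normal close) auto
  then have "1 / real K * \<bar>(SUP p\<in>?P. F \<mu> p) - (SUP p\<in>?P. F ?\<nu> p)\<bar>
      \<le> 1 / real K * (real (N * K) * (3 * \<rho> ^ 3 * C * (c\<mu> + cg)))"
    by (intro mult_left_mono) auto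
  also have "\<dots> = 24 / \<sigma> ^ 3 * C * (c\<mu> + cg) / sqrt (real N)"
  proof -
    \<comment> \<open>Of the N K exchanges, the factor K is removed by the normalisation per user; N
      copies of a cost of order N^(-3/2) remain.\<close>
    have "real N * \<rho> ^ 3 = 8 / \<sigma> ^ 3 * (real N / sqrt (real N) ^ 3)"
      by (simp add: \<rho>_def power_mult_distrib power_divide mult.commute)
    also have "real N / sqrt (real N) ^ 3 = 1 / sqrt (real N)"
      using N by (simp add: power3_eq_cube field_simps)
    finally have "real N * \<rho> ^ 3 = 8 / \<sigma> ^ 3 / sqrt (real N)" by simp
    moreover have "1 / real K * (real (N * K) * (3 * \<rho> ^ 3 * C * (c\<mu> + cg))) = (real N * \<rho> ^ 3) * (3 * C * (c\<mu> + cg))"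
      using K by simp
    ultimately show ?thesis by simp
  qed
  also have "1 / real K * \<bar>(SUP p\<in>?P. F \<mu> p) - (SUP p\<in>?P. F ?\<nu> p)\<bar> =
      \<bar>cdma_capacity \<mu> K N \<sigma> - cdma_capacity ?\<nu> K N \<sigma>\<bar>"
    unfolding cdma_capacity_def F_def right_diff_distrib[symmetric] abs_mult by simp
  finally show ?thesis .
qed

text \<open>K/\<beta> need not be an integer, so the fixed load is expressed by the limit
  \<open>ratio\<close>. Together with the quantitative bound, what remains is that N tends to
  infinity with K.\<close>

theorem theorem4:
  fixes \<mu> :: "real measure" and N :: "nat \<Rightarrow> nat" and \<beta> \<sigma> :: real
  assumes A: "assumption_A \<mu>"
    and unit_var: "integrable \<mu> (\<lambda>s. s\<^sup>2)" "(\<integral>s. s\<^sup>2 \<partial>\<mu>) = 1"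
    and beta: "0 < \<beta>" and N_pos: "\<And>K. 0 < N K"
    and ratio: "(\<lambda>K. real K / real (N K)) \<longlonglongrightarrow> \<beta>"
    and sigma: "0 < \<sigma>"
  shows "(\<lambda>K. cdma_capacity \<mu> K (N K) \<sigma> - cdma_capacity std_normal_distribution K (N K) \<sigma>)
           \<longlonglongrightarrow> 0"
proof -
  have prob: "prob_space \<mu>" and sets: "sets \<mu> = sets borel" and sym: "distr \<mu> borel uminus = \<mu>"
    using A by (auto simp: assumption_A_def)
  define c\<mu> where "c\<mu> = (\<integral>s. \<bar>s\<bar> ^ 3 \<partial>\<mu>)"
  define cg where "cg = (\<integral>s. \<bar>s\<bar> ^ 3 \<partial>std_normal_distribution)"
  \<comment> \<open>Gaussian value of the cubic moment, the number that the Nishimori identity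
    delivers for every channel.\<close>
  define C where "C = (\<integral>z. (1 + \<bar>z\<bar>) ^ 3 \<partial>std_normal_distribution)"
  define E where "E = 24 / \<sigma> ^ 3 * C * (c\<mu> + cg)"
  interpret G: prob_space std_normal_distribution by (rule prob_space_std_normal)
  have "integrable std_normal_distribution (\<lambda>z. 1 + 3 * \<bar>z\<bar> ^ 1 + 3 * \<bar>z\<bar> ^ 2 + \<bar>z\<bar> ^ 3)"
    by (intro Bochner_Integration.integrable_add integrable_mult_right integrable_std_normal_abs_moment) simp
  moreover have "(1 + \<bar>z\<bar>) ^ 3 = 1 + 3 * \<bar>z\<bar> ^ 1 + 3 * \<bar>z\<bar> ^ 2 + \<bar>z\<bar> ^ 3" for z :: real
    by (simp add: power3_eq_cube power2_eq_square algebra_simps)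
  ultimately have "integrable std_normal_distribution (\<lambda>z. (1 + \<bar>z\<bar>) ^ 3)"
    by (simp only:)
  then have C: "(\<integral>\<^sup>+z. ennreal ((1 + \<bar>z\<bar>) ^ 3) \<partial>std_normal_distribution) \<le> ennreal C"
    unfolding C_def by (subst nn_integral_eq_integral) auto
  have "0 \<le> C" unfolding C_def by (intro Bochner_Integration.integral_nonneg) auto
  have bound: "\<bar>cdma_capacity \<mu> K (N K) \<sigma> - cdma_capacity std_normal_distribution K (N K) \<sigma>\<bar>
      \<le> E / sqrt (real (N K))" if "0 < K" for K
    unfolding E_def
    by (rule capacity_swap[OF prob sets symmetric_mean_zero[OF prob sets sym unit_var(1)] _ _ _ C \<open>0 \<le> C\<close> that N_pos sigma])
      (use unit_var assumption_A_third_moment[OF A] integrable_std_normal_abs_moment[of 3]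
        in \<open>auto simp: has_bochner_integral_iff c\<mu>_def cg_def\<close>)
  \<comment> \<open>N is K times a factor with the positive limit 1/\<beta>, hence
    unbounded.\<close>
  have "(\<lambda>K. real (N K) / real K) \<longlonglongrightarrow> inverse \<beta>"
    using tendsto_inverse[OF ratio] beta by simp
  then have "filterlim (\<lambda>K. real (N K) / real K * real K) at_top sequentially"
    by (rule filterlim_tendsto_pos_mult_at_top) (use beta in \<open>simp_all add: filterlim_real_sequentially\<close>)
  \<comment> \<open>At K = 0 the quotient is 0 by convention and the cancellation fails, so the
    equality is only claimed eventually.\<close>
  moreover have "\<forall>\<^sub>F K in sequentially. real (N K) / real K * real K = real (N K)"
    using eventually_gt_at_top[of 0] by eventually_elim simp
  then have "filterlim (\<lambda>K. real (N K) / real K * real K) at_top sequentially \<longleftrightarrow>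
      filterlim (\<lambda>K. real (N K)) at_top sequentially"
    by (rule filterlim_cong[OF refl refl])
  ultimately have "filterlim (\<lambda>K. real (N K)) at_top sequentially" by (rule iffD1[rotated])
  then have "filterlim (\<lambda>K. sqrt (real (N K))) at_infinity sequentially"
    by (intro filterlim_at_top_imp_at_infinity filterlim_compose[OF sqrt_at_top])
  then have "(\<lambda>K. E / sqrt (real (N K))) \<longlonglongrightarrow> 0"
    by (rule tendsto_divide_0[OF tendsto_const])
  then show ?thesis
  proof (rule Lim_null_comparison[rotated])
    show "\<forall>\<^sub>F K in sequentially.
        norm (cdma_capacity \<mu> K (N K) \<sigma> - cdma_capacity std_normal_distribution K (N K) \<sigma>) \<le> E / sqrt (real (N K))"
      using eventually_gt_at_top[of 0] by eventually_elim (simp add: bound)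
  qed
qed

end
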